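(* Assume the setting and notation described in the context (in particular: both the original moment matrix $\mathscr M$ and the right-perturbed moment matrix $\hat{\mathscr M}$ admit Gauss--Borel factorizations, and all the zeros $x_1,\dots,x_M$, $M=Np-r$, of $\det R(x)$ are simple). Then the following equalities hold. (i) For all $n\ge 0$, $$\Omega_{n+M,n}=(-1)^M\frac{\tau_n}{\tau_{n+1}},\qquad \Omega_{n+1+i,n}=(-1)^{i+1}\frac{\tau_n^{(i)}}{\tau_{n+1}},\quad i\in\{0,\dots,M-1\}.$$ (ii) For all $n\ge 1$ and $b\in\{1,\dots,q\}$, $$\hat B^{(b)}_{n-1}(y)=\frac{1}{\tau_{n-1}}\begin{vmatrix}\mathbb K_b^{[n]}(x_1,y)&\mathbb A_n(x_1)&\cdots&\mathbb A_{n+M-2}(x_1)\\ \mathbb K_b^{[n]}(x_2,y)&\mathbb A_n(x_2)&\cdots&\mathbb A_{n+M-2}(x_2)\\ \vdots&\vdots&&\vdots\\ \mathbb K_b^{[n]}(x_M,y)&\mathbb A_n(x_M)&\cdots&\mathbb A_{n+M-2}(x_M)\end{vmatrix}.$$ (iii) For all $n\ge 0$ and $a\in\{1,\dots,p\}$, $$\sum_{\bar a=1}^p R_{a,\bar a}(x)\,\hat A_n^{(\bar a)}(x)=\frac{1}{\tau_{n+1}}\begin{vmatrix}A_n^{(a)}(x)&\cdots&A_{n+M-1}^{(a)}(x)&A_{n+M}^{(a)}(x)\\ \mathbb A_n(x_1)&\cdots&\mathbb A_{n+M-1}(x_1)&\mathbb A_{n+M}(x_1)\\ \vdots&&\vdots&\vdots\\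 \mathbb A_n(x_M)&\cdots&\mathbb A_{n+M-1}(x_M)&\mathbb A_{n+M}(x_M)\end{vmatrix},$$ where $R_{a,\bar a}(x)$ denotes the $(a,\bar a)$ entry of $R(x)$.
   Context: Original orthogonality. Let $p,q,N\ge1$ be integers and $r\in\{0,\dots,p-1\}$. Let $\mathrm d\mu=(\mathrm d\mu_{b,a})$ be a $q\times p$ matrix of measures supported on $\Delta\subseteq\mathbb R$, with all moments finite. For $s\in\mathbb N$ let $X_{[s]}(x)$ be the semi-infinite matrix obtained by stacking $I_s,xI_s,x^2I_s,\dots$ vertically. The moment matrix is $\mathscr M=\int_\Delta X_{[q]}(x)\,\mathrm d\mu(x)\,X_{[p]}^\top(x)$. It is assumed that all leading principal submatrices of $\mathscr M$ are nonsingular, so there is a unique Gauss--Borel factorization $\mathscr M=S^{-1}H\bar S^{-\top}$ with $S,\bar S$ lower unitriangular and $H$ nonsingular diagonal (semi-infinite matrices, rows and columns indexed from $0$). Put $B(x)=SX_{[q]}(x)$ and $A(x)=X_{[p]}^\top(x)\bar S^\top H^{-1}$; the entry of $B$ in row $n\in\mathbb N_0$ and column $b$ is $B_n^{(b)}$, and the entry of $A$ in row $a$ and column $n\in\mathbb N_0$ is $A_n^{(a)}$. The Christoffel--Darboux kernel $K^{[n]}(x,y)$ is the $p\times q$ matrix with entries $K^{[n]}_{a,b}(x,y)=\sum_{i=0}^{n-1}A_i^{(a)}(x)B_i^{(b)}(y)$. Perturbation. $R(x)=\sum_{l=0}^N R_lx^l$, $R_l\in\mathbb C^{p\times p}$,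 with $$R_N=\begin{bmatrix}0_{(p-r)\times r}&I_{p-r}\\0_{r\times r}&0_{r\times(p-r)}\end{bmatrix},\qquad R_{N-1}=\begin{bmatrix}R^1_{N-1}&R^2_{N-1}\\ I_r&R^4_{N-1}\end{bmatrix},$$ the blocks of $R_{N-1}$ having the same sizes as those of $R_N$ and $R^1_{N-1},R^2_{N-1},R^4_{N-1}$ arbitrary. Set $\mathrm d\hat\mu(x)=\mathrm d\mu(x)R(x)$ and $\hat{\mathscr M}=\int_\Delta X_{[q]}(x)\,\mathrm d\hat\mu(x)\,X_{[p]}^\top(x)$. It is assumed that $\hat{\mathscr M}$ also has a Gauss--Borel factorization $\hat{\mathscr M}=\hat S^{-1}\hat H\hat{\bar S}^{-\top}$ of the same type, and $\hat B=\hat SX_{[q]}$, $\hat A=X_{[p]}^\top\hat{\bar S}^\top\hat H^{-1}$, with entries $\hat B_n^{(b)}$, $\hat A_n^{(a)}$. The connection matrix is $\Omega=S\hat S^{-1}$, with entries $\Omega_{i,j}$, $i,j\in\mathbb N_0$. Simple eigenvalues. $\det R(x)$ has degree $M:=Np-r$, and its zeros $x_1,\dots,x_M$ are assumed simple (hence distinct). For each $i$ let $\boldsymbol v_i=(v_{i,1},\dots,v_{i,p})\neq0$ be a row vector with $\boldsymbol v_iR(x_i)=0$. Put $\mathbb A_n(x_i)=\sum_{a=1}^pv_{i,a}A_n^{(a)}(x_i)$ and $\mathbb K_b^{[n]}(x_i,y)=\sum_{a=1}^pv_{i,a}K_{a,b}^{[n]}(x_i,y)$. $\tau$ determinants. $\tau_n=\det\big[\mathbb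 A_{n+j}(x_i)\big]_{i=1,\dots,M;\ j=0,\dots,M-1}$. For $i\in\{0,\dots,M-1\}$, $\tau_n^{(i)}$ is the $M\times M$ determinant whose $k$-th row ($k=1,\dots,M$) is $\big(\mathbb A_n(x_k),\dots,\mathbb A_{n+i}(x_k),\mathbb A_{n+i+2}(x_k),\dots,\mathbb A_{n+M}(x_k)\big)$, i.e. the columns $n,\dots,n+M$ with column $n+i+1$ omitted; in particular $\tau_n^{(M-1)}=\tau_n$. *)

theory Defs
  imports
    "HOL-Analysis.Set_Integral"
    "HOL-Computational_Algebra.Polynomial"
    "Jordan_Normal_Form.Determinant"
begin

text \<open>All matrix and vector indices are counted from 0. Thus a component index \<open>a \<in> {1..p}\<close> of the
  usual notation is written \<open>a < p\<close>, and the zeros \<open>x\<^sub>1, \<dots>, x\<^sub>M\<close> are \<open>x 0, \<dots>, x (M - 1)\<close>.\<close>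

section \<open>Complex measures on the real line\<close>

text \<open>The countable additivity condition gives \<open>m {} = 0\<close>, because the constant series with terms
  \<open>m {}\<close> has to converge.\<close>

definition complex_measure :: "(real set \<Rightarrow> complex) \<Rightarrow> bool" where
  "complex_measure m \<longleftrightarrow>
     (\<forall>E :: nat \<Rightarrow> real set. range E \<subseteq> sets borel \<longrightarrow> disjoint_family E \<longrightarrow>
        (\<lambda>i. m (E i)) sums m (\<Union>i. E i))"

definition supported_on :: "real set \<Rightarrow> (real set \<Rightarrow> complex) \<Rightarrow> bool" where
  "supported_on \<Delta> m \<longleftrightarrow> (\<forall>E \<in> sets borel. E \<inter> \<Delta> = {} \<longrightarrow> m E = 0)"

text \<open>The positive part \<open>\<rho>\<^sup>+(E) = sup {\<rho>(F) | F \<subseteq> E}\<close> of the Jordan decomposition of a signed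
  measure \<open>\<rho>\<close>; the negative part is the positive part of \<open>- \<rho>\<close>. (\<open>ennreal\<close> sends negative numbers
  to 0, which does not change the supremum since \<open>\<rho>({}) = 0\<close>.)\<close>

definition pos_part :: "(real set \<Rightarrow> real) \<Rightarrow> real measure" where
  "pos_part \<rho> = measure_of UNIV (sets borel)
     (\<lambda>E. SUP F \<in> {F \<in> sets borel. F \<subseteq> E}. ennreal (\<rho> F))"

definition cm_integrable :: "(real set \<Rightarrow> complex) \<Rightarrow> real set \<Rightarrow> (real \<Rightarrow> complex) \<Rightarrow> bool" where
  "cm_integrable m \<Delta> f \<longleftrightarrow>
     set_integrable (pos_part (\<lambda>E. Re (m E))) \<Delta> f \<and>
     set_integrable (pos_part (\<lambda>E. - Re (m E))) \<Delta> f \<and>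
     set_integrable (pos_part (\<lambda>E. Im (m E))) \<Delta> f \<and>
     set_integrable (pos_part (\<lambda>E. - Im (m E))) \<Delta> f"

definition cm_integral :: "(real set \<Rightarrow> complex) \<Rightarrow> real set \<Rightarrow> (real \<Rightarrow> complex) \<Rightarrow> complex" where
  "cm_integral m \<Delta> f =
     ((LINT t:\<Delta>|pos_part (\<lambda>E. Re (m E)). f t) - (LINT t:\<Delta>|pos_part (\<lambda>E. - Re (m E)). f t)) +
     \<i> * ((LINT t:\<Delta>|pos_part (\<lambda>E. Im (m E)). f t) - (LINT t:\<Delta>|pos_part (\<lambda>E. - Im (m E)). f t))"

definition matrix_measure ::
    "nat \<Rightarrow> nat \<Rightarrow> real set \<Rightarrow> (nat \<Rightarrow> nat \<Rightarrow> real set \<Rightarrow> complex) \<Rightarrow> bool" where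
  "matrix_measure q p \<Delta> \<mu> \<longleftrightarrow> \<Delta> \<in> sets borel \<and>
     (\<forall>b<q. \<forall>a<p. complex_measure (\<mu> b a) \<and> supported_on \<Delta> (\<mu> b a) \<and>
        (\<forall>k::nat. cm_integrable (\<mu> b a) \<Delta> (\<lambda>t. of_real t ^ k)))"

text \<open>Consistency with the library: for a finite positive Borel measure the integral above is the
  Lebesgue integral.\<close>

lemma pos_part_measure:
  assumes "finite_measure M" and s: "sets M = sets borel"
  shows "pos_part (measure M) = M"
proof -
  interpret finite_measure M by fact
  have eq: "(SUP F \<in> {F \<in> sets borel. F \<subseteq> E}. ennreal (measure M F)) = emeasure M E"
    if "E \<in> sets borel" for E
  proof (rule antisym)
    show "(SUP F \<in> {F \<in> sets borel. F \<subseteq> E}. ennreal (measure M F)) \<le> emeasure M E"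
      using that by (auto intro!: SUP_least simp: emeasure_eq_measure[symmetric] s
          intro: emeasure_mono)
    show "emeasure M E \<le> (SUP F \<in> {F \<in> sets borel. F \<subseteq> E}. ennreal (measure M F))"
      using that by (auto intro!: SUP_upper2[of E] simp: emeasure_eq_measure)
  qed
  have "space M = UNIV"
    using sets_eq_imp_space_eq[OF s] by simp
  then have "M = measure_of UNIV (sets borel) (emeasure M)"
    using measure_of_of_measure[of M] s by simp
  also have "\<dots> = pos_part (measure M)"
    unfolding pos_part_def
  proof (rule measure_of_eq)
    fix E :: "real set" assume "E \<in> sigma_sets UNIV (sets borel)"
    then have "E \<in> sets borel"
      by (metis sets.sigma_sets_eq space_borel)
    then show "emeasure M E = (SUP F \<in> {F \<in> sets borel. F \<subseteq> E}. ennreal (measure M F))"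
      using eq by simp
  qed simp
  finally show ?thesis by simp
qed

lemma pos_part_nonpos:
  assumes "\<And>E. \<rho> E \<le> 0"
  shows "pos_part \<rho> = null_measure borel"
proof -
  have "(SUP F \<in> {F \<in> sets borel. F \<subseteq> E}. ennreal (\<rho> F)) = 0" for E
    using assms by (auto simp: SUP_eq_iff ennreal_neg intro!: antisym SUP_least)
  then show ?thesis
    unfolding pos_part_def null_measure_def by simp
qed

lemma cm_integral_measure:
  assumes "finite_measure M" "sets M = sets borel"
  shows "cm_integral (\<lambda>E. of_real (measure M E)) \<Delta> f = (LINT t:\<Delta>|M. f t)"
  by (simp add: cm_integral_def pos_part_measure[OF assms] pos_part_nonpos set_lebesgue_integral_def)

section \<open>Semi-infinite matrices\<close>

text \<open>Rectangular matrices with a finite number of columns (or rows) are also of this type; their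
  remaining columns (or rows) are irrelevant or 0.\<close>

type_synonym smat = "nat \<Rightarrow> nat \<Rightarrow> complex"

text \<open>In all the products that occur below, each of the series has only finitely many
  nonzero terms.\<close>

definition smat_mult :: "smat \<Rightarrow> smat \<Rightarrow> smat"  (infixl "\<star>" 70) where
  "(P \<star> Q) i j = (\<Sum>k. P i k * Q k j)"

definition smat_one :: smat where
  "smat_one i j = (if i = j then 1 else 0)"

definition smat_transpose :: "smat \<Rightarrow> smat" where
  "smat_transpose P i j = P j i"

text \<open>This is only used for lower unitriangular and for nonsingular diagonal matrices. For these,
  the two-sided inverse exists, and it is unique.\<close>

definition smat_inv :: "smat \<Rightarrow> smat" where
  "smat_inv P = (THE Q. P \<star> Q = smat_one \<and> Q \<star> P = smat_one)"

definition lower_unitriangular :: "smat \<Rightarrow> bool" where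
  "lower_unitriangular P \<longleftrightarrow> (\<forall>i. P i i = 1) \<and> (\<forall>i j. i < j \<longrightarrow> P i j = 0)"

definition nonsingular_diagonal :: "smat \<Rightarrow> bool" where
  "nonsingular_diagonal P \<longleftrightarrow> (\<forall>i. P i i \<noteq> 0) \<and> (\<forall>i j. i \<noteq> j \<longrightarrow> P i j = 0)"

definition gauss_borel :: "smat \<Rightarrow> smat \<Rightarrow> smat \<Rightarrow> smat \<Rightarrow> bool" where
  "gauss_borel \<M> S H Sb \<longleftrightarrow>
     lower_unitriangular S \<and> lower_unitriangular Sb \<and> nonsingular_diagonal H \<and>
     \<M> = smat_inv S \<star> H \<star> smat_transpose (smat_inv Sb)"

definition leading_submatrix :: "nat \<Rightarrow> smat \<Rightarrow> complex mat" where
  "leading_submatrix k P = mat k k (\<lambda>(i, j). P i j)"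

section \<open>Matrix polynomials\<close>

text \<open>The \<open>p \<times> p\<close> matrix polynomial with the coefficient matrices \<open>R 0, \<dots>, R N\<close>.\<close>

definition matrix_poly :: "nat \<Rightarrow> nat \<Rightarrow> (nat \<Rightarrow> complex mat) \<Rightarrow> complex poly mat" where
  "matrix_poly p N R = mat p p (\<lambda>(a, c). \<Sum>l\<le>N. monom (R l $$ (a, c)) l)"

definition eval_matrix_poly :: "complex poly mat \<Rightarrow> complex \<Rightarrow> complex mat" where
  "eval_matrix_poly P x = map_mat (\<lambda>f. poly f x) P"

section \<open>Moment matrices and mixed multiple orthogonal polynomials\<close>

text \<open>\<open>X\<^sub>[\<^sub>s\<^sub>]\<close>: row \<open>k = s m + c\<close> with \<open>c < s\<close> is \<open>x ^ m\<close> times the \<open>c\<close>-th unit row vector.\<close>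

definition X_mon :: "nat \<Rightarrow> complex \<Rightarrow> smat" where
  "X_mon s x k c = (if k mod s = c then x ^ (k div s) else 0)"

text \<open>\<open>\<integral> F d\<mu> G\<close> for a \<open>q \<times> p\<close> matrix of measures \<open>\<mu>\<close> and matrix functions \<open>F\<close>, \<open>G\<close> with \<open>q\<close> columns and
  \<open>p\<close> rows, respectively.\<close>

definition matrix_integral ::
    "nat \<Rightarrow> nat \<Rightarrow> real set \<Rightarrow> (real \<Rightarrow> smat) \<Rightarrow> (nat \<Rightarrow> nat \<Rightarrow> real set \<Rightarrow> complex) \<Rightarrow>
     (real \<Rightarrow> smat) \<Rightarrow> smat" where
  "matrix_integral q p \<Delta> F \<mu> G i j =
     (\<Sum>b<q. \<Sum>a<p. cm_integral (\<mu> b a) \<Delta> (\<lambda>t. F t i b * G t a j))"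

definition moment_matrix ::
    "nat \<Rightarrow> nat \<Rightarrow> real set \<Rightarrow> (nat \<Rightarrow> nat \<Rightarrow> real set \<Rightarrow> complex) \<Rightarrow> smat" where
  "moment_matrix q p \<Delta> \<mu> =
     matrix_integral q p \<Delta> (\<lambda>t. X_mon q (of_real t)) \<mu> (\<lambda>t. smat_transpose (X_mon p (of_real t)))"

text \<open>The moment matrix of \<open>d\<mu>(t) R(t)\<close>, that is \<open>\<integral> X\<^sub>[\<^sub>q\<^sub>](t) d\<mu>(t) R(t) X\<^sub>[\<^sub>p\<^sub>]\<^sup>T(t)\<close>.\<close>

definition perturbed_moment_matrix ::
    "nat \<Rightarrow> nat \<Rightarrow> real set \<Rightarrow> (nat \<Rightarrow> nat \<Rightarrow> real set \<Rightarrow> complex) \<Rightarrow> complex poly mat \<Rightarrow> smat" where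
  "perturbed_moment_matrix q p \<Delta> \<mu> P =
     matrix_integral q p \<Delta> (\<lambda>t. X_mon q (of_real t)) \<mu>
       (\<lambda>t a j. \<Sum>c<p. eval_matrix_poly P (of_real t) $$ (a, c) *
                      smat_transpose (X_mon p (of_real t)) c j)"

text \<open>\<open>B_poly q S y n b\<close> is \<open>B\<^sub>n\<^sup>(\<^sup>b\<^sup>)(y)\<close>, and \<open>A_poly p Sb H x a n\<close> is \<open>A\<^sub>n\<^sup>(\<^sup>a\<^sup>)(x)\<close>.\<close>

definition B_poly :: "nat \<Rightarrow> smat \<Rightarrow> complex \<Rightarrow> smat" where
  "B_poly q S y = S \<star> X_mon q y"

definition A_poly :: "nat \<Rightarrow> smat \<Rightarrow> smat \<Rightarrow> complex \<Rightarrow> smat" where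
  "A_poly p Sb H x = smat_transpose (X_mon p x) \<star> smat_transpose Sb \<star> smat_inv H"

definition CD_kernel ::
    "(complex \<Rightarrow> smat) \<Rightarrow> (complex \<Rightarrow> smat) \<Rightarrow> nat \<Rightarrow> complex \<Rightarrow> complex \<Rightarrow> smat" where
  "CD_kernel A B n x y a b = (\<Sum>i<n. A x a i * B y i b)"

text \<open>\<open>\<bbbA>\<^sub>n(x\<^sub>i)\<close> and \<open>\<bbbK>\<^sub>b\<^sup>[\<^sup>n\<^sup>](x\<^sub>i, y)\<close>.\<close>

definition AA :: "nat \<Rightarrow> (complex \<Rightarrow> smat) \<Rightarrow> (nat \<Rightarrow> complex) \<Rightarrow> (nat \<Rightarrow> complex vec) \<Rightarrow>
    nat \<Rightarrow> nat \<Rightarrow> complex" where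
  "AA p A x v n i = (\<Sum>a<p. vec_index (v i) a * A (x i) a n)"

definition KK :: "nat \<Rightarrow> (complex \<Rightarrow> smat) \<Rightarrow> (complex \<Rightarrow> smat) \<Rightarrow> (nat \<Rightarrow> complex) \<Rightarrow>
    (nat \<Rightarrow> complex vec) \<Rightarrow> nat \<Rightarrow> nat \<Rightarrow> nat \<Rightarrow> complex \<Rightarrow> complex" where
  "KK p A B x v n b i y = (\<Sum>a<p. vec_index (v i) a * CD_kernel A B n (x i) y a b)"

text \<open>\<open>\<tau>\<^sub>n\<close> and \<open>\<tau>\<^sub>n\<^sup>(\<^sup>i\<^sup>)\<close> as functions of the array \<open>F n k = \<bbbA>\<^sub>n(x\<^sub>k)\<close>. In the latter, the column
  \<open>n + i + 1\<close> is skipped.\<close>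

definition tau :: "nat \<Rightarrow> (nat \<Rightarrow> nat \<Rightarrow> complex) \<Rightarrow> nat \<Rightarrow> complex" where
  "tau M F n = Determinant.det (mat M M (\<lambda>(k, j). F (n + j) k))"

definition tau_skip :: "nat \<Rightarrow> (nat \<Rightarrow> nat \<Rightarrow> complex) \<Rightarrow> nat \<Rightarrow> nat \<Rightarrow> complex" where
  "tau_skip M F i n =
     Determinant.det (mat M M (\<lambda>(k, j). F (if j \<le> i then n + j else n + j + 1) k))"

end

theory Submission
  imports Defs
begin

text \<open>Writing \<open>R(x) X\<^sub>[\<^sub>p\<^sub>]\<^sup>T(x) = X\<^sub>[\<^sub>p\<^sub>]\<^sup>T(x) W\<close> with a constant semi-infinite matrix \<open>W\<close>, the perturbed moment matrix
  is \<open>\<M> W\<close>. The shape of the two leading coefficients of \<open>R\<close> says precisely that \<open>W\<close> has entries 1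
  on its \<open>M\<close>-th subdiagonal and zeros below it. Comparing the two factorizations gives
  \<open>\<Omega> = H Sb\<^sup>-\<^sup>T W Sbh\<^sup>T Hh\<^sup>-\<^sup>1\<close>, so that \<open>\<Omega>\<close> is lower unitriangular with exactly \<open>M\<close> further subdiagonals,
  the last of which does not vanish; moreover \<open>A \<Omega> = R Ah\<close> and \<open>B = \<Omega> Bh\<close>.

  Applying the left null vectors \<open>v\<^sub>i\<close> at \<open>x\<^sub>i\<close> turns \<open>A \<Omega> = R Ah\<close> into a linear recurrence of order \<open>M\<close>
  for the columns \<open>\<bbbA>\<^sub>n\<close>, and all the determinantal formulas are instances of Cramer's rule for it.
  By the recurrence, \<open>\<tau>\<^sub>n \<noteq> 0\<close> reduces to \<open>\<tau>\<^sub>0 \<noteq> 0\<close>. This in turn holds since the functionals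
  \<open>P \<mapsto> v\<^sub>i P(x\<^sub>i)\<close> on vector polynomials are linearly independent, the \<open>x\<^sub>i\<close> being distinct.\<close>

section \<open>Products and inverses of semi-infinite matrices\<close>

lemma smat_mult_sum:
  assumes "finite K" "\<And>k. k \<notin> K \<Longrightarrow> P i k * Q k j = 0"
  shows "(P \<star> Q) i j = (\<Sum>k\<in>K. P i k * Q k j)"
  unfolding smat_mult_def by (rule suminf_finite) (use assms in auto)

section \<open>Finiteness conditions under which products are associative\<close>

definition row_finite :: "smat \<Rightarrow> bool" where
  "row_finite P \<longleftrightarrow> (\<forall>i. finite {k. P i k \<noteq> 0})"

definition col_finite :: "smat \<Rightarrow> bool" where
  "col_finite P \<longleftrightarrow> row_finite (smat_transpose P)"

lemma col_finiteD: "col_finite P \<Longrightarrow> finite {k. P k j \<noteq> 0}"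
  unfolding col_finite_def row_finite_def smat_transpose_def by blast

lemma smat_transpose_transpose [simp]: "smat_transpose (smat_transpose P) = P"
  by (simp add: fun_eq_iff smat_transpose_def)

lemma smat_transpose_mult: "smat_transpose (P \<star> Q) = smat_transpose Q \<star> smat_transpose P"
  by (simp add: fun_eq_iff smat_transpose_def smat_mult_def mult.commute)

lemma row_finite_mult:
  assumes P: "row_finite P" and Q: "row_finite Q"
  shows "row_finite (P \<star> Q)"
  unfolding row_finite_def
proof
  fix i
  let ?K = "\<Union>l\<in>{l. P i l \<noteq> 0}. {k. Q l k \<noteq> 0}"
  have "(P \<star> Q) i k = 0" if "k \<notin> ?K" for k
    using that smat_mult_sum[of "{}" P i Q k] by auto
  then have "{k. (P \<star> Q) i k \<noteq> 0} \<subseteq> ?K" by blast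
  moreover have "finite ?K" using P Q by (auto simp: row_finite_def)
  ultimately show "finite {k. (P \<star> Q) i k \<noteq> 0}" by (rule finite_subset)
qed

lemma col_finite_mult: "col_finite P \<Longrightarrow> col_finite Q \<Longrightarrow> col_finite (P \<star> Q)"
  by (simp add: col_finite_def smat_transpose_mult row_finite_mult)

text \<open>Products are infinite series, so associativity is not automatic. Row \<open>i\<close> of
  \<open>P\<close> meets finitely many rows of \<open>Q\<close>, each with finite support, so both
  sides become one finite double sum, whatever \<open>T\<close> is.\<close>

lemma smat_assoc_row:
  assumes P: "row_finite P" and Q: "row_finite Q"
  shows "(P \<star> Q) \<star> T = P \<star> (Q \<star> T)"
proof (intro ext)
  fix i j
  let ?L = "{l. P i l \<noteq> 0}"
  let ?K = "\<Union>l\<in>?L. {k. Q l k \<noteq> 0}"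
  have fL: "finite ?L" and fK: "finite ?K" using P Q by (auto simp: row_finite_def)
  have PQ: "(P \<star> Q) i k = (\<Sum>l\<in>?L. P i l * Q l k)" for k
    by (rule smat_mult_sum) (use fL in auto)
  have "((P \<star> Q) \<star> T) i j = (\<Sum>k\<in>?K. (P \<star> Q) i k * T k j)"
    by (rule smat_mult_sum) (use fK in \<open>auto simp: PQ intro!: sum.neutral\<close>)
  also have "\<dots> = (\<Sum>l\<in>?L. \<Sum>k\<in>?K. P i l * Q l k * T k j)"
    by (subst sum.swap) (simp add: PQ sum_distrib_right)
  also have "\<dots> = (\<Sum>l\<in>?L. P i l * (Q \<star> T) l j)"
  proof (rule sum.cong[OF refl])
    fix l assume "l \<in> ?L"
    then have "(Q \<star> T) l j = (\<Sum>k\<in>?K. Q l k * T k j)"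
      by (intro smat_mult_sum fK) auto
    then show "(\<Sum>k\<in>?K. P i l * Q l k * T k j) = P i l * (Q \<star> T) l j"
      by (simp add: sum_distrib_left mult.assoc)
  qed
  also have "\<dots> = (P \<star> (Q \<star> T)) i j"
    by (rule smat_mult_sum[symmetric]) (use fL in auto)
  finally show "((P \<star> Q) \<star> T) i j = (P \<star> (Q \<star> T)) i j" .
qed

text \<open>The mirror image by transposition. Here the leftmost factor is arbitrary, which is what
  allows a full moment matrix in that place.\<close>

lemma smat_assoc_col:
  assumes "col_finite Q" "col_finite T"
  shows "(P \<star> Q) \<star> T = P \<star> (Q \<star> T)"
  using smat_assoc_row[of "smat_transpose T" "smat_transpose Q" "smat_transpose P"] assms
  unfolding col_finite_def by (metis smat_transpose_mult smat_transpose_transpose)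

lemma smat_one_mult [simp]: "smat_one \<star> P = P"
proof (intro ext)
  fix i j show "(smat_one \<star> P) i j = P i j"
    by (subst smat_mult_sum[of "{i}"]) (auto simp: smat_one_def)
qed

lemma smat_mult_one [simp]: "P \<star> smat_one = P"
proof (intro ext)
  fix i j show "(P \<star> smat_one) i j = P i j"
    by (subst smat_mult_sum[of "{j}"]) (auto simp: smat_one_def)
qed

lemma smat_transpose_one [simp]: "smat_transpose smat_one = smat_one"
  by (auto simp: fun_eq_iff smat_transpose_def smat_one_def)

text \<open>Entries on and above the \<open>m\<close>-th subdiagonal are unrestricted, so
  \<open>m = 0\<close> means upper triangular.\<close>

definition lower_band :: "nat \<Rightarrow> smat \<Rightarrow> bool" where
  "lower_band m P \<longleftrightarrow> (\<forall>i j. j + m < i \<longrightarrow> P i j = 0)"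

lemma lower_band_col_finite: "lower_band m P \<Longrightarrow> col_finite P"
  unfolding col_finite_def row_finite_def smat_transpose_def lower_band_def
  by (intro allI, rule_tac B = "{..i + m}" in finite_subset) (auto simp: not_less[symmetric])

text \<open>Only \<open>k = j + l\<close> contributes: a smaller \<open>k\<close> lies above the
  band of \<open>P\<close> reached from this row, a larger one is below the band of
  \<open>Q\<close>. Hence outermost subdiagonals multiply entrywise.\<close>

lemma lower_band_mult_lead:
  assumes P: "lower_band m P" and Q: "lower_band l Q"
  shows "(P \<star> Q) (j + (m + l)) j = P (j + l + m) (j + l) * Q (j + l) j"
proof -
  have "P (j + (m + l)) k * Q k j = 0" if "k \<noteq> j + l" for k
    using P Q that unfolding lower_band_def by (cases "k < j + l") auto
  then have "(P \<star> Q) (j + (m + l)) j = (\<Sum>k\<in>{j + l}. P (j + (m + l)) k * Q k j)"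
    by (intro smat_mult_sum) auto
  then show ?thesis by (simp add: ac_simps)
qed

lemma lower_band_mult:
  assumes P: "lower_band m P" and Q: "lower_band l Q"
  shows "lower_band (m + l) (P \<star> Q)"
  unfolding lower_band_def
proof (intro allI impI)
  fix i j assume ij: "j + (m + l) < i"
  have "P i k * Q k j = 0" for k
    using P Q ij unfolding lower_band_def by (cases "k + m < i") auto
  then show "(P \<star> Q) i j = 0"
    using smat_mult_sum[of "{}" P i Q j] by simp
qed

lemma lower_unitriangular_row_finite: "lower_unitriangular P \<Longrightarrow> row_finite P"
  unfolding row_finite_def lower_unitriangular_def
  by (intro allI, rule_tac B = "{..i}" in finite_subset) (auto simp: not_less[symmetric])

lemma lower_unitriangular_transpose_band:
  "lower_unitriangular P \<Longrightarrow> lower_band 0 (smat_transpose P)"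
  by (simp add: lower_unitriangular_def lower_band_def smat_transpose_def)

lemma lower_unitriangular_mult:
  assumes P: "lower_unitriangular P" and Q: "lower_unitriangular Q"
  shows "lower_unitriangular (P \<star> Q)"
proof -
  let ?T = "smat_transpose Q \<star> smat_transpose P"
  have eq: "P \<star> Q = smat_transpose ?T"
    by (simp add: smat_transpose_mult)
  have "lower_band 0 ?T"
    using lower_band_mult[OF lower_unitriangular_transpose_band[OF Q]
        lower_unitriangular_transpose_band[OF P]] by simp
  moreover have "?T j j = 1" for j
    using lower_band_mult_lead[OF lower_unitriangular_transpose_band[OF Q]
        lower_unitriangular_transpose_band[OF P], of j] P Q
    by (simp add: lower_unitriangular_def smat_transpose_def)
  ultimately show ?thesis
    unfolding eq lower_unitriangular_def lower_band_def by (simp add: smat_transpose_def)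
qed

text \<open>Forward substitution, row by row, for a right inverse of a matrix with unit
  diagonal.\<close>

fun forward_inverse :: "smat \<Rightarrow> smat" where
  "forward_inverse P i j = smat_one i j - (\<Sum>k<i. P i k * forward_inverse P k j)"

declare forward_inverse.simps [simp del]

lemma forward_inverse:
  assumes P: "lower_unitriangular P"
  shows "lower_unitriangular (forward_inverse P)" "P \<star> forward_inverse P = smat_one"
proof -
  have 0: "forward_inverse P i j = 0" if "i < j" for i j
    using that
  proof (induction i rule: less_induct)
    case (less i)
    then show ?case
      by (subst forward_inverse.simps) (simp add: smat_one_def)
  qed
  moreover have "forward_inverse P i i = 1" for i
    by (subst forward_inverse.simps) (simp add: 0 smat_one_def)
  ultimately show "lower_unitriangular (forward_inverse P)"
    by (simp add: lower_unitriangular_def)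
  show "P \<star> forward_inverse P = smat_one"
  proof (intro ext)
    fix i j
    have "(P \<star> forward_inverse P) i j = (\<Sum>k<Suc i. P i k * forward_inverse P k j)"
      by (rule smat_mult_sum) (use P in \<open>auto simp: lower_unitriangular_def\<close>)
    also have "\<dots> = smat_one i j"
      using P forward_inverse.simps[of P i j] by (simp add: lower_unitriangular_def)
    finally show "(P \<star> forward_inverse P) i j = smat_one i j" .
  qed
qed

text \<open>Uniqueness has to hold among all matrices, since \<open>smat_inv\<close> is a definite
  description. Any competitor \<open>Q'\<close> equals
  \<open>(Q \<star> P) \<star> Q' = Q \<star> (P \<star> Q') = Q\<close>, where the regrouping uses
  the row finiteness of \<open>Q\<close> and \<open>P\<close> only.\<close>

lemma smat_inv_eqI:
  assumes "row_finite P" "row_finite Q" "P \<star> Q = smat_one" "Q \<star> P = smat_one"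
  shows "smat_inv P = Q"
  unfolding smat_inv_def
proof (rule the_equality)
  fix Q' assume "P \<star> Q' = smat_one \<and> Q' \<star> P = smat_one"
  then show "Q' = Q"
    using smat_assoc_row[OF assms(2,1), of Q'] assms by simp
qed (use assms in simp)

lemma smat_inv_lower_unitriangular:
  assumes P: "lower_unitriangular P"
  shows "lower_unitriangular (smat_inv P)" "P \<star> smat_inv P = smat_one" "smat_inv P \<star> P = smat_one"
proof -
  let ?Q = "forward_inverse P" and ?T = "forward_inverse (forward_inverse P)"
  note Q = forward_inverse[OF P]
  note T = forward_inverse[OF Q(1)]
  \<comment> \<open>The right inverse \<open>?Q\<close> has in turn a right inverse
    \<open>?T\<close>, and \<open>P = P \<star> (?Q \<star> ?T) = (P \<star> ?Q) \<star> ?T =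
    ?T\<close>. So the right inverse is also a left inverse.\<close>
  have "P = ?T"
    using smat_assoc_row[OF lower_unitriangular_row_finite[OF P]
        lower_unitriangular_row_finite[OF Q(1)], of ?T] Q T by simp
  then have QP: "?Q \<star> P = smat_one"
    using T by simp
  have "smat_inv P = ?Q"
    using P Q QP by (intro smat_inv_eqI lower_unitriangular_row_finite)
  then show "lower_unitriangular (smat_inv P)" "P \<star> smat_inv P = smat_one"
    "smat_inv P \<star> P = smat_one"
    using Q QP by simp_all
qed

lemma nonsingular_diagonal_row_finite:
  assumes "nonsingular_diagonal P"
  shows "row_finite P"
  unfolding row_finite_def
proof
  fix i
  have "P i k = 0" if "k \<noteq> i" for k
    using assms that by (simp add: nonsingular_diagonal_def)
  then have "{k. P i k \<noteq> 0} \<subseteq> {i}"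
    by blast
  then show "finite {k. P i k \<noteq> 0}"
    by (rule finite_subset) simp
qed

lemma nonsingular_diagonal_band: "nonsingular_diagonal P \<Longrightarrow> lower_band 0 P"
  by (simp add: nonsingular_diagonal_def lower_band_def)

lemma smat_inv_nonsingular_diagonal:
  assumes P: "nonsingular_diagonal P"
  shows "nonsingular_diagonal (smat_inv P)" "P \<star> smat_inv P = smat_one" "smat_inv P \<star> P = smat_one"
proof -
  let ?Q = "\<lambda>i j. if i = j then 1 / P i i else 0"
  have Q: "nonsingular_diagonal ?Q"
    using P by (simp add: nonsingular_diagonal_def)
  have PQ: "P \<star> ?Q = smat_one"
  proof (intro ext)
    fix i j show "(P \<star> ?Q) i j = smat_one i j"
      using P by (subst smat_mult_sum[of "{i}"]) (auto simp: nonsingular_diagonal_def smat_one_def)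
  qed
  have QP: "?Q \<star> P = smat_one"
  proof (intro ext)
    fix i j show "(?Q \<star> P) i j = smat_one i j"
      using P by (subst smat_mult_sum[of "{i}"]) (auto simp: nonsingular_diagonal_def smat_one_def)
  qed
  have "smat_inv P = ?Q"
    using P Q PQ QP by (intro smat_inv_eqI nonsingular_diagonal_row_finite)
  then show "nonsingular_diagonal (smat_inv P)" "P \<star> smat_inv P = smat_one"
    "smat_inv P \<star> P = smat_one"
    using Q PQ QP by simp_all
qed

section \<open>Determinants with a known linear relation between the columns\<close>

text \<open>The vector \<open>w\<close> is in the kernel of all rows but the top one. Replacing
  column 0 by the combination of columns with weights \<open>w\<close> multiplies the determinant by
  \<open>w 0 = 1\<close> and leaves a single possibly nonzero entry in that column.\<close>

lemma det_bordered:
  fixes c :: "nat \<Rightarrow> nat \<Rightarrow> 'a :: field"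
  assumes w0: "w 0 = 1" and rel: "\<And>k. k < M \<Longrightarrow> (\<Sum>j\<le>M. c j k * w j) = 0"
  shows "Determinant.det (mat (M + 1) (M + 1) (\<lambda>(i, j). if i = 0 then u j else c j (i - 1))) =
    (\<Sum>j\<le>M. u j * w j) * Determinant.det (mat M M (\<lambda>(k, j). c (j + 1) k))"
proof -
  let ?D = "mat (M + 1) (M + 1) (\<lambda>(i, j). if i = 0 then u j else c j (i - 1))"
  let ?w = "vec (M + 1) w"
  define E where "E = replace_col ?D (?D *\<^sub>v ?w) 0"
  have Dw: "?D *\<^sub>v ?w = vec (M + 1) (\<lambda>i. if i = 0 then \<Sum>j\<le>M. u j * w j else 0)"
  proof (rule eq_vecI)
    fix i assume "i < dim_vec (vec (M + 1) (\<lambda>i. if i = 0 then \<Sum>j\<le>M. u j * w j else 0))"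
    then show "vec_index (?D *\<^sub>v ?w) i =
        vec_index (vec (M + 1) (\<lambda>i. if i = 0 then \<Sum>j\<le>M. u j * w j else 0)) i"
      using rel[of "i - 1"]
      by (auto simp: scalar_prod_def atLeast0LessThan lessThan_Suc_atMost)
  qed simp
  have E: "E = mat (M + 1) (M + 1) (\<lambda>(i, j). if j = 0 then if i = 0 then \<Sum>j\<le>M. u j * w j else 0
      else if i = 0 then u j else c j (i - 1))"
    unfolding E_def Dw by (intro eq_matI) (auto simp: replace_col_def)
  have "Determinant.det ?D = Determinant.det E"
    using cramer_lemma_mat[of ?D "M + 1" ?w 0] w0 by (simp add: E_def)
  also have "\<dots> = (\<Sum>i<M + 1. E $$ (i, 0) * cofactor E i 0)"
    by (rule laplace_expansion_column) (simp_all add: E)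
  also have "\<dots> = (\<Sum>i\<in>{0}. E $$ (i, 0) * cofactor E i 0)"
    by (rule sum.mono_neutral_right) (auto simp: E)
  also have "\<dots> = (\<Sum>j\<le>M. u j * w j) * Determinant.det (mat_delete E 0 0)"
    by (simp add: cofactor_def E)
  also have "mat_delete E 0 0 = mat M M (\<lambda>(k, j). c (j + 1) k)"
    by (intro eq_matI) (auto simp: mat_delete_def E)
  finally show ?thesis .
qed

text \<open>With the \<open>s\<close>-th unit vector as top row, expansion along that row gives the
  minor without column \<open>s\<close>, up to the sign \<open>(-1) ^ s\<close>, while
  \<open>det_bordered\<close> evaluates the same determinant as \<open>w s\<close> times the minor
  without column 0.\<close>

lemma det_skip_column:
  fixes c :: "nat \<Rightarrow> nat \<Rightarrow> 'a :: field"
  assumes w0: "w 0 = 1" and rel: "\<And>k. k < M \<Longrightarrow> (\<Sum>j\<le>M. c j k * w j) = 0" and s: "s \<le> M"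
  shows "Determinant.det (mat M M (\<lambda>(k, j). c (if j < s then j else j + 1) k)) =
    (- 1) ^ s * w s * Determinant.det (mat M M (\<lambda>(k, j). c (j + 1) k))"
proof -
  let ?D = "mat (M + 1) (M + 1) (\<lambda>(i, j). if i = 0 then if j = s then 1 else 0 else c j (i - 1))"
  have "Determinant.det ?D = (\<Sum>j<M + 1. ?D $$ (0, j) * cofactor ?D 0 j)"
    by (rule laplace_expansion_row) simp_all
  also have "\<dots> = (\<Sum>j<M + 1. if j = s then cofactor ?D 0 s else 0)"
    by (intro sum.cong refl) auto
  also have "\<dots> = (- 1) ^ s * Determinant.det (mat_delete ?D 0 s)"
    using s by (simp add: cofactor_def sum.delta)
  also have "mat_delete ?D 0 s = mat M M (\<lambda>(k, j). c (if j < s then j else j + 1) k)"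
    using s by (intro eq_matI) (auto simp: mat_delete_def)
  finally have "(- 1) ^ s * Determinant.det (mat M M (\<lambda>(k, j). c (if j < s then j else j + 1) k)) =
      (\<Sum>j\<le>M. (if j = s then 1 else 0) * w j) * Determinant.det (mat M M (\<lambda>(k, j). c (j + 1) k))"
    using det_bordered[of w M c "\<lambda>j. if j = s then 1 else 0", OF w0 rel] by simp
  also have "(\<Sum>j\<le>M. (if j = s then 1 else 0) * w j) = w s"
    using s by (subst sum.mono_neutral_right[of _ "{s}"]) auto
  finally have "(- 1) ^ s * ((- 1) ^ s * Determinant.det (mat M M (\<lambda>(k, j). c (if j < s then j else j + 1) k))) =
      (- 1) ^ s * (w s * Determinant.det (mat M M (\<lambda>(k, j). c (j + 1) k)))"
    by simp
  then show ?thesis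
    by (simp flip: mult.assoc power_add)
qed

lemma power_moments_zero:
  fixes x d :: "nat \<Rightarrow> 'a :: field"
  assumes inj: "inj_on x {..<M}" and moments: "\<And>m. (\<Sum>k<M. d k * x k ^ m) = 0" and i: "i < M"
  shows "d i = 0"
proof -
  \<comment> \<open>An unnormalized Lagrange polynomial: it vanishes at every node except
    \<open>x i\<close>, and its weighted sum over the nodes is a combination of the moments.\<close>
  let ?f = "\<Prod>l\<in>{..<M} - {i}. [:- x l, 1:]"
  have "(\<Sum>k<M. d k * poly ?f (x k)) = (\<Sum>m\<le>degree ?f. coeff ?f m * (\<Sum>k<M. d k * x k ^ m))"
    unfolding poly_altdef sum_distrib_left by (subst sum.swap) (simp add: ac_simps)
  then have "0 = (\<Sum>k<M. d k * poly ?f (x k))"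
    by (simp add: moments)
  also have "\<dots> = (\<Sum>k\<in>{i}. d k * poly ?f (x k))"
    by (rule sum.mono_neutral_right) (use i in \<open>auto simp: poly_prod\<close>)
  finally have "d i * poly ?f (x i) = 0"
    by simp
  moreover have "poly ?f (x i) \<noteq> 0"
    using inj i by (auto simp: poly_prod inj_on_def)
  ultimately show ?thesis by simp
qed

section \<open>The connection matrix\<close>

lemma gauss_borelD:
  assumes "gauss_borel Mo S H Sb"
  shows "lower_unitriangular S" "lower_unitriangular Sb" "nonsingular_diagonal H"
    "Mo = smat_inv S \<star> H \<star> smat_transpose (smat_inv Sb)"
  using assms by (simp_all only: gauss_borel_def)

lemma gauss_borel_right_inverses:
  assumes "gauss_borel Mo S H Sb"
  shows "smat_inv H \<star> H = smat_one" "H \<star> smat_inv H = smat_one"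
    "smat_transpose Sb \<star> smat_transpose (smat_inv Sb) = smat_one"
    "smat_transpose (smat_inv Sb) \<star> smat_transpose Sb = smat_one"
  using smat_inv_nonsingular_diagonal[OF gauss_borelD(3)[OF assms]]
    smat_inv_lower_unitriangular[OF gauss_borelD(2)[OF assms]]
  by (simp_all flip: smat_transpose_mult)

lemma gauss_borel_col_finite:
  assumes "gauss_borel Mo S H Sb"
  shows "col_finite H" "col_finite (smat_inv H)" "col_finite (smat_transpose Sb)"
    "col_finite (smat_transpose (smat_inv Sb))"
proof -
  note H = gauss_borelD(3)[OF assms] and Sb = gauss_borelD(2)[OF assms]
  note diag = lower_band_col_finite[OF nonsingular_diagonal_band]
    and upper = lower_band_col_finite[OF lower_unitriangular_transpose_band]
  show "col_finite H" "col_finite (smat_inv H)" "col_finite (smat_transpose Sb)"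
    "col_finite (smat_transpose (smat_inv Sb))"
    by (rule diag[OF H] diag[OF smat_inv_nonsingular_diagonal(1)[OF H]] upper[OF Sb]
        upper[OF smat_inv_lower_unitriangular(1)[OF Sb]])+
qed

section \<open>The connection matrix of two moment matrices \<open>Mo\<close> and
  \<open>Mo \<star> W\<close>\<close>

context
  fixes Mo W S H Sb Sh Hh Sbh \<Omega> :: smat and m :: nat
  assumes gb: "gauss_borel Mo S H Sb" and gb_hat: "gauss_borel (Mo \<star> W) Sh Hh Sbh"
    and W: "lower_band m W" and W_lead: "\<And>j. W (j + m) j = 1"
    and \<Omega>: "\<Omega> = S \<star> smat_inv Sh"
begin

lemma connection_unitriangular: "lower_unitriangular \<Omega>"
  unfolding \<Omega>
  by (intro lower_unitriangular_mult smat_inv_lower_unitriangular gauss_borelD(1)[OF gb]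
      gauss_borelD(1)[OF gb_hat])

text \<open>The product of \<open>Mo \<star> W\<close> with the right inverse \<open>?Z\<close> of
  \<open>Hh \<star> ?V\<close> is computed twice, once from each factorization. The results are the
  inverse of \<open>Sh\<close> and an expression starting with the inverse of \<open>S\<close>,
  which \<open>S\<close> then cancels.\<close>

lemma connection_factorization:
  "\<Omega> = H \<star> (smat_transpose (smat_inv Sb) \<star> (W \<star> (smat_transpose Sbh \<star> smat_inv Hh)))"
proof -
  let ?U = "smat_transpose (smat_inv Sb)" and ?V = "smat_transpose (smat_inv Sbh)"
  let ?Z = "smat_transpose Sbh \<star> smat_inv Hh"
  note S = gauss_borelD(1)[OF gb] and H = gauss_borelD(3)[OF gb] and Mo = gauss_borelD(4)[OF gb]
    and MoW = gauss_borelD(4)[OF gb_hat]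
  note S' = smat_inv_lower_unitriangular[OF S]
  note cf = gauss_borel_col_finite[OF gb] gauss_borel_col_finite[OF gb_hat]
    lower_band_col_finite[OF W] col_finite_mult
  have "?V \<star> ?Z = ?V \<star> smat_transpose Sbh \<star> smat_inv Hh"
    by (intro smat_assoc_col[symmetric] cf)
  then have VZ: "?V \<star> ?Z = smat_inv Hh"
    by (simp add: gauss_borel_right_inverses[OF gb_hat])
  have "(Mo \<star> W) \<star> ?Z = smat_inv Sh \<star> (Hh \<star> (?V \<star> ?Z))"
    unfolding MoW by (simp add: smat_assoc_col cf)
  then have 1: "(Mo \<star> W) \<star> ?Z = smat_inv Sh"
    by (simp add: VZ gauss_borel_right_inverses[OF gb_hat])
  have "(Mo \<star> W) \<star> ?Z = Mo \<star> (W \<star> ?Z)"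
    by (intro smat_assoc_col cf)
  also have "\<dots> = (smat_inv S \<star> H) \<star> (?U \<star> (W \<star> ?Z))"
    unfolding Mo by (intro smat_assoc_col cf)
  also have "\<dots> = smat_inv S \<star> (H \<star> (?U \<star> (W \<star> ?Z)))"
    by (intro smat_assoc_row lower_unitriangular_row_finite nonsingular_diagonal_row_finite S' H)
  finally have 2: "(Mo \<star> W) \<star> ?Z = smat_inv S \<star> (H \<star> (?U \<star> (W \<star> ?Z)))" .
  have "\<Omega> = S \<star> (smat_inv S \<star> (H \<star> (?U \<star> (W \<star> ?Z))))"
    unfolding \<Omega> 2[symmetric] 1 ..
  also have "\<dots> = (S \<star> smat_inv S) \<star> (H \<star> (?U \<star> (W \<star> ?Z)))"
    by (intro smat_assoc_row[symmetric] lower_unitriangular_row_finite S S')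
  finally show ?thesis
    by (simp add: S')
qed

text \<open>In the factorization every factor except \<open>W\<close> is upper triangular, so the
  band width is that of \<open>W\<close>. The outermost entry is a product of diagonal entries, of
  which only those of \<open>H\<close> and of the inverse of \<open>Hh\<close> differ from
  1.\<close>

lemma connection_band: "lower_band m \<Omega>"
  and connection_lead: "\<Omega> (n + m) n \<noteq> 0"
proof -
  let ?U = "smat_transpose (smat_inv Sb)"
  note H = gauss_borelD(3)[OF gb] and Sbh = gauss_borelD(2)[OF gb_hat]
    and Hh' = smat_inv_nonsingular_diagonal(1)[OF gauss_borelD(3)[OF gb_hat]]
    and Sb' = smat_inv_lower_unitriangular(1)[OF gauss_borelD(2)[OF gb]]
  note bH = nonsingular_diagonal_band[OF H] and bHh = nonsingular_diagonal_band[OF Hh']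
    and bSb = lower_unitriangular_transpose_band[OF Sb']
    and bSbh = lower_unitriangular_transpose_band[OF Sbh]
  note b1 = lower_band_mult[OF bSbh bHh]
  note b2 = lower_band_mult[OF W b1]
  note b3 = lower_band_mult[OF bSb b2]
  show "lower_band m \<Omega>"
    using lower_band_mult[OF bH b3] by (simp add: connection_factorization)
  have "\<Omega> (n + m) n = H (n + m) (n + m) * smat_inv Hh n n"
    using lower_band_mult_lead[OF bH b3, of n] lower_band_mult_lead[OF bSb b2, of n]
      lower_band_mult_lead[OF W b1, of n] lower_band_mult_lead[OF bSbh bHh, of n] W_lead[of n] Sb' Sbh
    by (simp add: connection_factorization lower_unitriangular_def smat_transpose_def)
  then show "\<Omega> (n + m) n \<noteq> 0"
    using H Hh' by (simp add: nonsingular_diagonal_def)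
qed

text \<open>The inverse of \<open>H\<close> and the transpose of \<open>Sb\<close> cancel the first
  two factors of \<open>connection_factorization\<close>. For the monomial matrix \<open>X\<close>
  this becomes the relation between the polynomials \<open>A\<close> and \<open>Ah\<close>.\<close>

lemma connection_right:
  assumes "col_finite X"
  shows "X \<star> smat_transpose Sb \<star> smat_inv H \<star> \<Omega> = X \<star> W \<star> smat_transpose Sbh \<star> smat_inv Hh"
proof -
  note inv = gauss_borel_right_inverses(1,3)[OF gb]
  note cf = gauss_borel_col_finite[OF gb] gauss_borel_col_finite[OF gb_hat]
    lower_band_col_finite[OF W] col_finite_mult
  let ?Y = "W \<star> (smat_transpose Sbh \<star> smat_inv Hh)"
  have "smat_inv H \<star> \<Omega> = (smat_inv H \<star> H) \<star> (smat_transpose (smat_inv Sb) \<star> ?Y)"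
    unfolding connection_factorization by (intro smat_assoc_col[symmetric] cf)
  then have "smat_transpose Sb \<star> (smat_inv H \<star> \<Omega>) =
      smat_transpose Sb \<star> (smat_transpose (smat_inv Sb) \<star> ?Y)"
    by (simp only: inv smat_one_mult)
  also have "\<dots> = (smat_transpose Sb \<star> smat_transpose (smat_inv Sb)) \<star> ?Y"
    by (intro smat_assoc_col[symmetric] cf)
  finally have *: "smat_transpose Sb \<star> (smat_inv H \<star> \<Omega>) = ?Y"
    by (simp only: inv smat_one_mult)
  have "X \<star> smat_transpose Sb \<star> smat_inv H \<star> \<Omega> = X \<star> (smat_transpose Sb \<star> (smat_inv H \<star> \<Omega>))"
    using lower_band_col_finite[OF connection_band] by (simp add: smat_assoc_col cf)
  then show ?thesis
    unfolding * by (simp add: smat_assoc_col cf)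
qed

lemma connection_left: "S \<star> Y = \<Omega> \<star> (Sh \<star> Y)"
proof -
  note Sh = gauss_borelD(1)[OF gb_hat] and S = gauss_borelD(1)[OF gb]
  note Sh' = smat_inv_lower_unitriangular[OF Sh]
  note rf = lower_unitriangular_row_finite
  have "\<Omega> \<star> (Sh \<star> Y) = (\<Omega> \<star> Sh) \<star> Y"
    by (intro smat_assoc_row[symmetric] rf Sh connection_unitriangular)
  also have "\<Omega> \<star> Sh = S \<star> (smat_inv Sh \<star> Sh)"
    unfolding \<Omega> by (intro smat_assoc_row rf S Sh')
  finally show ?thesis by (simp add: Sh')
qed

end

text \<open>Inverts the change of basis from monomials to the polynomials \<open>A\<close>: each
  column of monomials is a finite combination of columns of \<open>A\<close>.\<close>

lemma gauss_borel_right_recover: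
  assumes gb: "gauss_borel Mo S H Sb"
  shows "X \<star> smat_transpose Sb \<star> smat_inv H \<star> (H \<star> smat_transpose (smat_inv Sb)) = X"
proof -
  let ?U = "smat_transpose (smat_inv Sb)"
  note inv = gauss_borel_right_inverses(1,3)[OF gb] and cf = gauss_borel_col_finite[OF gb]
  have "smat_inv H \<star> (H \<star> ?U) = smat_inv H \<star> H \<star> ?U"
    by (intro smat_assoc_col[symmetric] cf)
  then have "smat_inv H \<star> (H \<star> ?U) = ?U"
    by (simp add: inv)
  then show ?thesis
    by (simp add: smat_assoc_col cf col_finite_mult inv)
qed

section \<open>Perturbation of the moment matrix\<close>

lemma cm_integral_sum:
  assumes "finite K" and "\<And>k. k \<in> K \<Longrightarrow> cm_integrable m \<Delta> (f k)"
  shows "cm_integral m \<Delta> (\<lambda>t. \<Sum>k\<in>K. f k t * w k) = (\<Sum>k\<in>K. cm_integral m \<Delta> (f k) * w k)"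
proof -
  have lin: "(LINT t:\<Delta>|\<nu>. \<Sum>k\<in>K. f k t * w k) = (\<Sum>k\<in>K. (LINT t:\<Delta>|\<nu>. f k t) * w k)"
    if "\<And>k. k \<in> K \<Longrightarrow> set_integrable \<nu> \<Delta> (f k)" for \<nu>
  proof -
    have "(LINT t:\<Delta>|\<nu>. \<Sum>k\<in>K. f k t * w k) = integral\<^sup>L \<nu> (\<lambda>t. \<Sum>k\<in>K. (indicator \<Delta> t *\<^sub>R f k t) * w k)"
      unfolding set_lebesgue_integral_def scaleR_sum_right mult_scaleR_left ..
    also have "\<dots> = (\<Sum>k\<in>K. integral\<^sup>L \<nu> (\<lambda>t. (indicator \<Delta> t *\<^sub>R f k t) * w k))"
      using that unfolding set_integrable_def
      by (intro Bochner_Integration.integral_sum integrable_mult_left)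
    also have "\<dots> = (\<Sum>k\<in>K. (LINT t:\<Delta>|\<nu>. f k t) * w k)"
      using that unfolding set_integrable_def set_lebesgue_integral_def
      by (intro sum.cong refl integral_mult_left)
    finally show ?thesis .
  qed
  have "set_integrable (pos_part (\<lambda>E. Re (m E))) \<Delta> (f k)"
    "set_integrable (pos_part (\<lambda>E. - Re (m E))) \<Delta> (f k)"
    "set_integrable (pos_part (\<lambda>E. Im (m E))) \<Delta> (f k)"
    "set_integrable (pos_part (\<lambda>E. - Im (m E))) \<Delta> (f k)" if "k \<in> K" for k
    using assms(2)[OF that] by (simp_all add: cm_integrable_def)
  then show ?thesis
    unfolding cm_integral_def
    by (simp add: lin ring_distribs sum.distrib sum_subtractf sum_distrib_left mult.assoc)
qed

text \<open>The matrix of right multiplication by the matrix polynomial in the basis of the columns of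
  \<open>X\<^sub>[\<^sub>p\<^sub>]\<^sup>T\<close>: column \<open>j\<close> of \<open>R(z) X\<^sub>[\<^sub>p\<^sub>]\<^sup>T(z)\<close> is that of \<open>X\<^sub>[\<^sub>p\<^sub>]\<^sup>T(z) W\<close>.\<close>

definition poly_band :: "nat \<Rightarrow> nat \<Rightarrow> (nat \<Rightarrow> complex mat) \<Rightarrow> smat" where
  "poly_band p N R k j =
     (if j div p \<le> k div p \<and> k div p \<le> j div p + N
      then R (k div p - j div p) $$ (k mod p, j mod p) else 0)"

lemma X_mon_transpose_col_finite: "col_finite (smat_transpose (X_mon p z))"
  unfolding col_finite_def row_finite_def
proof
  fix k
  have "{c. smat_transpose (smat_transpose (X_mon p z)) k c \<noteq> 0} \<subseteq> {k mod p}"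
    by (auto simp: X_mon_def)
  then show "finite {c. smat_transpose (smat_transpose (X_mon p z)) k c \<noteq> 0}"
    by (rule finite_subset) simp
qed

lemma poly_band_col_finite:
  assumes "p \<ge> 1"
  shows "col_finite (poly_band p N R)"
  unfolding col_finite_def row_finite_def
proof
  fix j
  have "k < (j div p + N + 1) * p" if "k div p \<le> j div p + N" for k
    using that assms div_less_iff_less_mult[of p k "j div p + N + 1"] by linarith
  then have "{k. smat_transpose (poly_band p N R) j k \<noteq> 0} \<subseteq> {..<(j div p + N + 1) * p}"
    by (auto simp: poly_band_def smat_transpose_def split: if_splits)
  then show "finite {k. smat_transpose (poly_band p N R) j k \<noteq> 0}"
    by (rule finite_subset) simp
qed

text \<open>Column \<open>j\<close> of the monomial matrix is \<open>z ^ (j div p)\<close> times the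
  unit vector \<open>j mod p\<close>. The coefficient \<open>R l\<close> sends it to degree
  \<open>l + j div p\<close>, whose component \<open>a\<close> has the index
  \<open>a + p * (l + j div p)\<close>.\<close>

lemma matrix_poly_mult_X_mon:
  assumes p: "p \<ge> 1" and a: "a < p"
  shows "(\<Sum>c<p. eval_matrix_poly (matrix_poly p N R) z $$ (a, c) * smat_transpose (X_mon p z) c j) =
    (smat_transpose (X_mon p z) \<star> poly_band p N R) a j"
proof -
  let ?k = "\<lambda>l. a + p * (l + j div p)"
  have j: "j mod p < p" using p by simp
  have "(\<Sum>c<p. eval_matrix_poly (matrix_poly p N R) z $$ (a, c) * smat_transpose (X_mon p z) c j) =
      (\<Sum>c\<in>{j mod p}. eval_matrix_poly (matrix_poly p N R) z $$ (a, c) * z ^ (j div p))"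
    by (rule sum.mono_neutral_cong_right) (use j in \<open>auto simp: X_mon_def smat_transpose_def\<close>)
  also have "\<dots> = (\<Sum>l\<le>N. R l $$ (a, j mod p) * z ^ (l + j div p))"
    using a j by (simp add: eval_matrix_poly_def matrix_poly_def poly_sum poly_monom
        sum_distrib_right power_add mult.assoc)
  also have "\<dots> = (\<Sum>k\<in>?k ` {..N}. smat_transpose (X_mon p z) a k * poly_band p N R k j)"
    using p a by (subst sum.reindex)
      (auto simp: inj_on_def X_mon_def smat_transpose_def poly_band_def mult.commute)
  also have "\<dots> = (smat_transpose (X_mon p z) \<star> poly_band p N R) a j"
  proof (rule smat_mult_sum[symmetric])
    fix k assume k: "k \<notin> ?k ` {..N}"
    show "smat_transpose (X_mon p z) a k * poly_band p N R k j = 0"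
    proof (rule ccontr)
      assume "smat_transpose (X_mon p z) a k * poly_band p N R k j \<noteq> 0"
      then have *: "k mod p = a" "j div p \<le> k div p" "k div p \<le> j div p + N"
        by (auto simp: X_mon_def smat_transpose_def poly_band_def split: if_splits)
      then have "k div p - j div p + j div p = k div p"
        by simp
      then have "k = ?k (k div p - j div p)"
        by (simp only: mod_mult_div_eq flip: *(1))
      moreover have "k div p - j div p \<in> {..N}"
        using * by simp
      ultimately have "k \<in> ?k ` {..N}"
        by (rule image_eqI)
      with k show False ..
    qed
  qed simp
  finally show ?thesis .
qed

lemma perturbed_moment_matrix_eq:
  assumes p: "p \<ge> 1" and meas: "matrix_measure q p \<Delta> \<mu>"
  shows "perturbed_moment_matrix q p \<Delta> \<mu> (matrix_poly p N R) =
    moment_matrix q p \<Delta> \<mu> \<star> poly_band p N R"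
proof (intro ext)
  fix i j
  let ?W = "poly_band p N R"
  let ?X = "\<lambda>t. smat_transpose (X_mon p (complex_of_real t))"
  let ?Y = "\<lambda>t. X_mon q (complex_of_real t)"
  let ?K = "{k. ?W k j \<noteq> 0}"
  have K: "finite ?K"
    by (rule col_finiteD[OF poly_band_col_finite[OF p]])
  \<comment> \<open>Each integrand is a single power of \<open>t\<close> or zero, so finiteness of
    the moments suffices to exchange sum and integral.\<close>
  have int: "cm_integrable (\<mu> b a) \<Delta> (\<lambda>t. ?Y t i b * ?X t a k)" if "b < q" "a < p" for a b k
  proof -
    have pow: "cm_integrable (\<mu> b a) \<Delta> (\<lambda>t. complex_of_real t ^ l)" for l
      using meas that by (simp add: matrix_measure_def)
    show ?thesis
    proof (cases "i mod q = b \<and> k mod p = a")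
      case True
      then show ?thesis
        using pow[of "i div q + k div p"] by (simp add: X_mon_def smat_transpose_def power_add)
    next
      case False
      then have "(\<lambda>t. ?Y t i b * ?X t a k) = (\<lambda>t. 0)"
        by (auto simp: X_mon_def smat_transpose_def)
      then show ?thesis
        by (simp add: cm_integrable_def set_integrable_def)
    qed
  qed
  have "perturbed_moment_matrix q p \<Delta> \<mu> (matrix_poly p N R) i j =
      (\<Sum>b<q. \<Sum>a<p. cm_integral (\<mu> b a) \<Delta> (\<lambda>t. \<Sum>k\<in>?K. (?Y t i b * ?X t a k) * ?W k j))"
    unfolding perturbed_moment_matrix_def matrix_integral_def
  proof (intro sum.cong refl arg_cong[where f = "cm_integral _ \<Delta>"] ext)
    fix a t assume "a \<in> {..<p}"
    then have "(\<Sum>c<p. eval_matrix_poly (matrix_poly p N R) (complex_of_real t) $$ (a, c) * ?X t c j) =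
        (?X t \<star> ?W) a j"
      by (intro matrix_poly_mult_X_mon p) simp
    also have "\<dots> = (\<Sum>k\<in>?K. ?X t a k * ?W k j)"
      by (rule smat_mult_sum[OF K]) simp
    finally show "?Y t i b * (\<Sum>c<p. eval_matrix_poly (matrix_poly p N R) (complex_of_real t) $$ (a, c) *
        ?X t c j) = (\<Sum>k\<in>?K. (?Y t i b * ?X t a k) * ?W k j)" for b
      by (simp add: sum_distrib_left mult.assoc)
  qed
  also have "\<dots> = (\<Sum>b<q. \<Sum>a<p. \<Sum>k\<in>?K. cm_integral (\<mu> b a) \<Delta> (\<lambda>t. ?Y t i b * ?X t a k) * ?W k j)"
    using K int by (intro sum.cong refl cm_integral_sum) auto
  also have "\<dots> = (\<Sum>k\<in>?K. moment_matrix q p \<Delta> \<mu> i k * ?W k j)"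
    unfolding moment_matrix_def matrix_integral_def sum_distrib_right
    by (simp only: sum.swap[of _ ?K])
  also have "\<dots> = (moment_matrix q p \<Delta> \<mu> \<star> ?W) i j"
    by (rule smat_mult_sum[symmetric]) (use K in auto)
  finally show "perturbed_moment_matrix q p \<Delta> \<mu> (matrix_poly p N R) i j =
    (moment_matrix q p \<Delta> \<mu> \<star> ?W) i j" .
qed

text \<open>Write \<open>j = u * p + w\<close> with \<open>w < p\<close>. Moving down by
  \<open>N * p - r\<close> leads to block \<open>u + N\<close>, row \<open>w - r\<close>, if
  \<open>r \<le> w\<close>, and to block \<open>u + (N - 1)\<close>, row \<open>w + (p - r)\<close>,
  otherwise. These are the diagonal positions of the identity blocks of \<open>R N\<close> and of
  \<open>R (N - 1)\<close>, respectively.\<close>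

lemma poly_band_structure:
  fixes R :: "nat \<Rightarrow> complex mat"
  assumes p: "1 \<le> p" and N: "1 \<le> N" and r: "r \<le> p - 1"
    and R_N: "R N = four_block_mat (0\<^sub>m (p - r) r) (1\<^sub>m (p - r)) (0\<^sub>m r r) (0\<^sub>m r (p - r))"
    and R1: "R1 \<in> carrier_mat (p - r) r" and R4: "R4 \<in> carrier_mat r (p - r)"
    and R_N1: "R (N - 1) = four_block_mat R1 R2 (1\<^sub>m r) R4"
  shows "lower_band (N * p - r) (poly_band p N R)"
    and "poly_band p N R (j + (N * p - r)) j = 1"
proof -
  have top: "R N $$ (a, c) = (if c = a + r then 1 else 0)" if "a < p" "c < p" for a c
    using that r by (auto simp: R_N)
  have sub: "R (N - 1) $$ (a, c) = (if a = c + (p - r) then 1 else 0)"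
    if a: "p - r \<le> a" "a < p" and c: "c < r" for a c
  proof -
    have "R (N - 1) $$ (a, c) = 1\<^sub>m r $$ (a - (p - r), c)"
      unfolding R_N1 using a c r carrier_matD[OF R1] carrier_matD[OF R4]
      by (subst index_mat_four_block(1)) simp_all
    also have "\<dots> = (if a - (p - r) = c then 1 else 0)"
      using a c by (intro index_one_mat) linarith+
    also have "a - (p - r) = c \<longleftrightarrow> a = c + (p - r)"
      using a by linarith
    finally show ?thesis .
  qed
  have rp: "r \<le> p"
    using r by simp
  have shift_ge: "j + (N * p - r) = (j div p + N) * p + (j mod p - r)" if "r \<le> j mod p" for j
  proof -
    have "p \<le> N * p"
      using N by simp
    then have "r \<le> N * p"
      using rp by linarith
    then have "u * p + w + (N * p - r) = (u + N) * p + (w - r)" if "r \<le> w" for u w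
      using that by (simp add: add_mult_distrib)
    from this[OF that, of "j div p"] show ?thesis by simp
  qed
  have shift_less: "j + (N * p - r) = (j div p + (N - 1)) * p + (j mod p + (p - r))" for j
  proof -
    obtain n where "N = Suc n"
      using N by (cases N) auto
    then have "u * p + w + (N * p - r) = (u + (N - 1)) * p + (w + (p - r))" for u w
      using rp by (simp add: add_mult_distrib)
    from this[of "j div p" "j mod p"] show ?thesis by simp
  qed
  have div_mod: "(u * p + w) div p = u" "(u * p + w) mod p = w" if "w < p" for u w
    using that by auto
  have lt: "j mod p < p" for j using p by simp
  show "poly_band p N R (j + (N * p - r)) j = 1"
  proof (cases "r \<le> j mod p")
    case True
    note eq = shift_ge[OF True]
    have less: "j mod p - r < p" using lt[of j] by linarith
    have "(j + (N * p - r)) div p = j div p + N" "(j + (N * p - r)) mod p = j mod p - r"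
      unfolding eq by (rule div_mod[OF less])+
    then show ?thesis
      using True lt[of j] less by (simp add: poly_band_def top)
  next
    case False
    note eq = shift_less[of j]
    have less: "j mod p + (p - r) < p" using False r p by linarith
    have dm: "(j + (N * p - r)) div p = j div p + (N - 1)"
      "(j + (N * p - r)) mod p = j mod p + (p - r)"
      unfolding eq by (rule div_mod[OF less])+
    have "j div p + (N - 1) - j div p = N - 1" "j div p \<le> j div p + (N - 1)"
      "j div p + (N - 1) \<le> j div p + N" "p - r \<le> j mod p + (p - r)" "j mod p < r"
      using False by linarith+
    then show ?thesis
      unfolding poly_band_def dm by (simp only: sub less simp_thms if_True)
  qed
  show "lower_band (N * p - r) (poly_band p N R)"
    unfolding lower_band_def
  proof (intro allI impI)
    fix k j assume "j + (N * p - r) < k"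
    then have k: "j + (N * p - r) < k div p * p + k mod p" by simp
    have k': "k div p * p + k mod p < (k div p + 1) * p"
      by (simp only: add_mult_distrib nat_mult_1 add_less_cancel_left lt)
    consider "k div p = j div p + N" | "j div p + N < k div p"
      | "k div p = j div p + (N - 1)" "k div p < j div p + N"
      | "k div p < j div p + (N - 1)"
      using N by linarith
    then show "poly_band p N R k j = 0"
    proof cases
      case 1
      then have "j mod p \<noteq> k mod p + r"
        using k shift_ge[of j] by auto
      then show ?thesis
        using 1 lt[of j] lt[of k] by (simp add: poly_band_def top)
    next
      case 2
      then show ?thesis by (simp add: poly_band_def)
    next
      case 3
      \<comment> \<open>For \<open>r \<le> j mod p\<close> the outermost subdiagonal is already in
        block \<open>j div p + N\<close>, so no row of the preceding block lies below it.\<close>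
      have "\<not> r \<le> j mod p"
      proof
        assume "r \<le> j mod p"
        then have "(j div p + N) * p < k div p * p + k mod p"
          using k shift_ge[of j] by linarith
        also note k'
        also have "(k div p + 1) * p \<le> (j div p + N) * p"
          using 3 by (intro mult_right_mono) auto
        finally show False by simp
      qed
      moreover from this have "j mod p + (p - r) < k mod p"
        using k 3 unfolding shift_less[of j] by simp
      moreover have "k div p - j div p = N - 1" "j div p \<le> k div p" "k div p \<le> j div p + N"
        using 3 by linarith+
      ultimately show ?thesis
        using lt[of k] by (simp add: poly_band_def sub del: One_nat_def)
    next
      case 4
      have "(k div p + 1) * p \<le> j + (N * p - r)"
      proof (cases "r \<le> j mod p")
        case True
        have "(k div p + 1) * p \<le> (j div p + N) * p"
          using 4 by (intro mult_right_mono) auto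
        then show ?thesis unfolding shift_ge[OF True] by linarith
      next
        case False
        have "(k div p + 1) * p \<le> (j div p + (N - 1)) * p"
          using 4 by (intro mult_right_mono) auto
        then show ?thesis unfolding shift_less[of j] by linarith
      qed
      then show ?thesis using k k' by linarith
    qed
  qed
qed

section \<open>Christoffel formulas\<close>

lemma smat_mult_linear_row:
  assumes P: "\<And>k. P a k = (\<Sum>c<p. w c * X c k)" and Z: "col_finite Z"
  shows "(P \<star> Z) a n = (\<Sum>c<p. w c * (X \<star> Z) c n)"
proof -
  let ?K = "{k. Z k n \<noteq> 0}"
  have prod: "(Y \<star> Z) i n = (\<Sum>k\<in>?K. Y i k * Z k n)" for Y i
    using Z by (intro smat_mult_sum col_finiteD) auto
  have "(P \<star> Z) a n = (\<Sum>k\<in>?K. \<Sum>c<p. w c * (X c k * Z k n))"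
    unfolding prod P by (simp add: sum_distrib_right mult.assoc)
  also have "\<dots> = (\<Sum>c<p. w c * (X \<star> Z) c n)"
    unfolding prod sum_distrib_left by (rule sum.swap)
  finally show ?thesis .
qed

text \<open>A vector \<open>d\<close> annihilating the first \<open>M\<close> columns of \<open>F\<close> annihilates all of them by the
  recurrence, hence also all the moments of the weights \<open>d\<^sub>k w\<^sub>k\<^sub>a\<close> at the points \<open>x\<^sub>k\<close>.\<close>

lemma tau_0_nonzero:
  fixes F G :: "nat \<Rightarrow> nat \<Rightarrow> complex"
  assumes inj: "inj_on x {..<M}"
    and rec: "\<And>n k. k < M \<Longrightarrow> (\<Sum>j\<le>M. F (n + j) k * \<Omega> (n + j) n) = 0"
    and lead: "\<And>n. \<Omega> (n + M) n \<noteq> 0"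
    and recover: "\<And>a l k. a < p \<Longrightarrow> k < M \<Longrightarrow> w k a * x k ^ l = (\<Sum>i\<in>K a l. F i k * G i (l * p + a))"
    and nonzero: "\<And>k. k < M \<Longrightarrow> \<exists>a<p. w k a \<noteq> 0"
  shows "tau M F 0 \<noteq> 0"
proof
  let ?D = "mat M M (\<lambda>(k, j). F j k)"
  assume "tau M F 0 = 0"
  \<comment> \<open>Transposing turns the kernel vector into a linear dependence \<open>d\<close>
    among the rows, that is, among the evaluations at the points \<open>x k\<close>.\<close>
  then have "Determinant.det (transpose_mat ?D) = 0"
    by (subst det_transpose[of _ M]) (simp_all add: tau_def)
  then obtain d where d: "d \<in> carrier_vec M" "d \<noteq> 0\<^sub>v M" "transpose_mat ?D *\<^sub>v d = 0\<^sub>v M"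
    by (subst (asm) det_0_iff_vec_prod_zero[of _ M]) auto
  define f where "f j = (\<Sum>k<M. F j k * vec_index d k)" for j
  have "f j = vec_index (transpose_mat ?D *\<^sub>v d) j" if "j < M" for j
    using that d(1) by (simp add: f_def scalar_prod_def atLeast0LessThan)
  then have init: "f j = 0" if "j < M" for j
    using that d(3) by simp
  have f_rec: "(\<Sum>j\<le>M. f (n + j) * \<Omega> (n + j) n) = 0" for n
  proof -
    have "(\<Sum>j\<le>M. f (n + j) * \<Omega> (n + j) n) =
        (\<Sum>j\<le>M. \<Sum>k<M. vec_index d k * (F (n + j) k * \<Omega> (n + j) n))"
      by (simp add: f_def sum_distrib_right sum_distrib_left ac_simps)
    also have "\<dots> = (\<Sum>k<M. vec_index d k * (\<Sum>j\<le>M. F (n + j) k * \<Omega> (n + j) n))"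
      unfolding sum_distrib_left by (rule sum.swap)
    finally show ?thesis by (simp add: rec)
  qed
  have f0: "f j = 0" for j
  proof (induction j rule: less_induct)
    case (less j)
    show ?case
    proof (cases "j < M")
      case False
      define n where "n = j - M"
      have j: "j = n + M" using False by (simp add: n_def)
      have "(\<Sum>i\<le>M. f (n + i) * \<Omega> (n + i) n) = (\<Sum>i\<in>{M}. f (n + i) * \<Omega> (n + i) n)"
        by (rule sum.mono_neutral_right) (use less j in auto)
      then show ?thesis using f_rec[of n] lead[of n] j by simp
    qed (rule init)
  qed
  have "vec_index d k = 0" if k: "k < M" for k
  proof -
    obtain a where a: "a < p" "w k a \<noteq> 0" using nonzero[OF k] by auto
    have "(\<Sum>k<M. (vec_index d k * w k a) * x k ^ l) = 0" for l
    proof -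
      have "(\<Sum>k<M. (vec_index d k * w k a) * x k ^ l) =
          (\<Sum>k<M. vec_index d k * (\<Sum>i\<in>K a l. F i k * G i (l * p + a)))"
        using recover[OF a(1)] by (intro sum.cong refl) (simp add: mult.assoc)
      also have "\<dots> = (\<Sum>i\<in>K a l. f i * G i (l * p + a))"
        unfolding f_def sum_distrib_left sum_distrib_right
        by (subst sum.swap) (simp add: ac_simps)
      finally show ?thesis by (simp add: f0)
    qed
    then have "vec_index d k * w k a = 0"
      by (rule power_moments_zero[OF inj _ k])
    then show ?thesis using a by simp
  qed
  then have "d = 0\<^sub>v M"
    using d(1) by (intro eq_vecI) auto
  with d(2) show False ..
qed

lemma solve_signed_product:
  fixes u w t :: "'a :: field"
  assumes "t = (-1) ^ k * w * u" "u \<noteq> 0"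
  shows "w = (-1) ^ k * (t / u)"
  using assms by (cases "even k") simp_all

lemma sum_lessThan_add:
  fixes f :: "nat \<Rightarrow> 'a :: comm_monoid_add"
  shows "(\<Sum>i<n + m. f i) = (\<Sum>i<n. f i) + (\<Sum>j<m. f (n + j))"
  by (induction m) (simp_all add: add.assoc)

theorem theorem4p9:
  fixes p q N r M :: nat
    and \<Delta> :: "real set"
    and \<mu> :: "nat \<Rightarrow> nat \<Rightarrow> real set \<Rightarrow> complex"
    and S H Sb Sh Hh Sbh \<Omega> :: smat
    and R :: "nat \<Rightarrow> complex mat"
    and R1 R2 R4 :: "complex mat"
    and RP :: "complex poly mat"
    and A B Ah Bh :: "complex \<Rightarrow> smat"
    and x :: "nat \<Rightarrow> complex"
    and v :: "nat \<Rightarrow> complex vec"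
    and \<A> :: "nat \<Rightarrow> nat \<Rightarrow> complex"
    and \<K> :: "nat \<Rightarrow> nat \<Rightarrow> nat \<Rightarrow> complex \<Rightarrow> complex"
    and \<tau> :: "nat \<Rightarrow> complex"
    and \<tau>s :: "nat \<Rightarrow> nat \<Rightarrow> complex"
  assumes p: "1 \<le> p" and q: "1 \<le> q" and N: "1 \<le> N" and r: "r \<le> p - 1"
    and measure: "matrix_measure q p \<Delta> \<mu>"
    and nonsingular: "\<And>k. Determinant.det (leading_submatrix k (moment_matrix q p \<Delta> \<mu>)) \<noteq> 0"
    and factorization: "gauss_borel (moment_matrix q p \<Delta> \<mu>) S H Sb"
    and A_eq: "A = A_poly p Sb H" and B_eq: "B = B_poly q S"
    and R_dim: "\<And>l. l \<le> N \<Longrightarrow> R l \<in> carrier_mat p p"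
    and R_N: "R N = four_block_mat (0\<^sub>m (p - r) r) (1\<^sub>m (p - r)) (0\<^sub>m r r) (0\<^sub>m r (p - r))"
    and R1: "R1 \<in> carrier_mat (p - r) r"
    and R2: "R2 \<in> carrier_mat (p - r) (p - r)"
    and R4: "R4 \<in> carrier_mat r (p - r)"
    and R_N1: "R (N - 1) = four_block_mat R1 R2 (1\<^sub>m r) R4"
    and RP_eq: "RP = matrix_poly p N R"
    and factorization_hat: "gauss_borel (perturbed_moment_matrix q p \<Delta> \<mu> RP) Sh Hh Sbh"
    and Ah_eq: "Ah = A_poly p Sbh Hh" and Bh_eq: "Bh = B_poly q Sh"
    and \<Omega>_eq: "\<Omega> = S \<star> smat_inv Sh"
    and M_eq: "M = N * p - r"
    and zeros_distinct: "inj_on x {..<M}"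
    and zeros: "x ` {..<M} = {z. poly (Determinant.det RP) z = 0}"
    and zeros_simple: "\<And>i. i < M \<Longrightarrow> Polynomial.order (x i) (Determinant.det RP) = 1"
    and v: "\<And>i. i < M \<Longrightarrow> v i \<in> carrier_vec p \<and> v i \<noteq> 0\<^sub>v p \<and>
              transpose_mat (eval_matrix_poly RP (x i)) *\<^sub>v v i = 0\<^sub>v p"
    and \<A>_eq: "\<A> = AA p A x v" and \<K>_eq: "\<K> = KK p A B x v"
    and \<tau>_eq: "\<tau> = tau M \<A>" and \<tau>s_eq: "\<tau>s = tau_skip M \<A>"
  shows "(\<forall>n. \<tau> n \<noteq> 0) \<and>
    (\<forall>n. \<Omega> (n + M) n = (-1) ^ M * (\<tau> n / \<tau> (n + 1)) \<and>
      (\<forall>i<M. \<Omega> (n + 1 + i) n = (-1) ^ (i + 1) * (\<tau>s i n / \<tau> (n + 1)))) \<and>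
    (\<forall>n\<ge>1. \<forall>b<q. \<forall>y. Bh y (n - 1) b =
      1 / \<tau> (n - 1) *
      Determinant.det (mat M M (\<lambda>(i, j). if j = 0 then \<K> n b i y else \<A> (n + (j - 1)) i))) \<and>
    (\<forall>n. \<forall>a<p. \<forall>z. (\<Sum>c<p. eval_matrix_poly RP z $$ (a, c) * Ah z c n) =
      1 / \<tau> (n + 1) *
      Determinant.det (mat (M + 1) (M + 1)
        (\<lambda>(i, j). if i = 0 then A z a (n + j) else \<A> (n + j) (i - 1))))"
proof -
  define W where "W = poly_band p N R"
  note gb = factorization
  have gb_hat: "gauss_borel (moment_matrix q p \<Delta> \<mu> \<star> W) Sh Hh Sbh"
    using factorization_hat unfolding RP_eq perturbed_moment_matrix_eq[OF p measure] W_def .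
  have M_pos: "0 < M"
  proof -
    have "p \<le> N * p" using N by simp
    then show ?thesis using r p M_eq by linarith
  qed
  note band_structure = poly_band_structure[OF p N r R_N R1 R4 R_N1]
  have W: "lower_band M W" and W_lead: "W (j + M) j = 1" for j
    using band_structure unfolding W_def M_eq by blast+
  note conn = gb gb_hat W W_lead \<Omega>_eq
  have unit: "lower_unitriangular \<Omega>" by (rule connection_unitriangular[OF conn])
  have lead: "\<Omega> (n + M) n \<noteq> 0" for n by (rule connection_lead[OF conn])
  have diag: "\<Omega> n n = 1" and upper: "i < n \<Longrightarrow> \<Omega> i n = 0" for i n
    using unit by (simp_all add: lower_unitriangular_def)
  have band: "\<Omega> i n = 0" if "n + M < i" for i n
    using connection_band[OF conn] that by (simp add: lower_band_def)

  \<comment> \<open>The recurrences satisfied by \<open>A\<close> and \<open>\<A>\<close>\<close>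
  let ?RA = "\<lambda>z a n. \<Sum>c<p. eval_matrix_poly RP z $$ (a, c) * Ah z c n"
  \<comment> \<open>The cutoff \<open>L\<close> is kept free: \<open>n + M + 1\<close> gives the
    recurrence of order \<open>M\<close>, while a cutoff common to several columns serves the
    formula for \<open>Bh\<close>.\<close>
  have A_connection: "(\<Sum>i<L. A z a i * \<Omega> i n) = ?RA z a n" if a: "a < p" and L: "n + M < L" for z a n L
  proof -
    let ?X = "smat_transpose (X_mon p z)" and ?Z = "smat_transpose Sbh \<star> smat_inv Hh"
    note cf = gauss_borel_col_finite[OF gb_hat]
    have "(\<Sum>i<L. A z a i * \<Omega> i n) = (A z \<star> \<Omega>) a n"
      by (rule smat_mult_sum[symmetric]) (use band L in auto)
    also have "A z \<star> \<Omega> = ?X \<star> W \<star> smat_transpose Sbh \<star> smat_inv Hh"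
      unfolding A_eq A_poly_def by (rule connection_right[OF conn X_mon_transpose_col_finite])
    also have "\<dots> = ?X \<star> W \<star> ?Z"
      by (intro smat_assoc_col cf)
    also have "(?X \<star> W \<star> ?Z) a n =
        (\<Sum>c<p. eval_matrix_poly RP z $$ (a, c) * (?X \<star> ?Z) c n)"
      by (intro smat_mult_linear_row col_finite_mult cf)
        (simp only: W_def RP_eq matrix_poly_mult_X_mon[OF p a])
    also have "?X \<star> ?Z = Ah z"
      unfolding Ah_eq A_poly_def by (rule smat_assoc_col[symmetric]) (rule cf)+
    finally show ?thesis .
  qed
  have shift: "(\<Sum>i<n + M + 1. f i * \<Omega> i n) = (\<Sum>j\<le>M. f (n + j) * \<Omega> (n + j) n)" for f n
    using sum_lessThan_add[of "\<lambda>i. f i * \<Omega> i n" n "M + 1"] upper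
    by (simp add: lessThan_Suc_atMost)
  have A_rec: "(\<Sum>j\<le>M. A z a (n + j) * \<Omega> (n + j) n) = ?RA z a n" if "a < p" for z a n
    using A_connection[OF that, of n "n + M + 1" z] unfolding shift by simp

  have AA_rec': "(\<Sum>i<L. \<A> i k * \<Omega> i n) = 0" if k: "k < M" and L: "n + M < L" for k n L
  proof -
    have ker: "(\<Sum>a<p. vec_index (v k) a * eval_matrix_poly RP (x k) $$ (a, c)) = 0" if "c < p" for c
    proof -
      have dims: "dim_row (eval_matrix_poly RP (x k)) = p" "dim_col (eval_matrix_poly RP (x k)) = p"
        "dim_vec (v k) = p"
        using v[OF k] by (auto simp: RP_eq matrix_poly_def eval_matrix_poly_def)
      have "vec_index (transpose_mat (eval_matrix_poly RP (x k)) *\<^sub>v v k) c = 0"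
        using v[OF k] that by simp
      then show ?thesis
        using that by (simp add: dims scalar_prod_def atLeast0LessThan mult.commute)
    qed
    have "(\<Sum>i<L. \<A> i k * \<Omega> i n) = (\<Sum>a<p. vec_index (v k) a * (\<Sum>i<L. A (x k) a i * \<Omega> i n))"
      unfolding \<A>_eq AA_def sum_distrib_left sum_distrib_right
      by (subst sum.swap) (simp add: mult.assoc)
    also have "\<dots> = (\<Sum>a<p. vec_index (v k) a * ?RA (x k) a n)"
      using A_connection[OF _ L] by simp
    also have "\<dots> = (\<Sum>c<p. (\<Sum>a<p. vec_index (v k) a * eval_matrix_poly RP (x k) $$ (a, c)) * Ah (x k) c n)"
      unfolding sum_distrib_left sum_distrib_right by (subst sum.swap) (simp add: mult.assoc)
    also have "\<dots> = 0"
      using ker by simp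
    finally show ?thesis .
  qed
  have AA_rec: "(\<Sum>j\<le>M. \<A> (n + j) k * \<Omega> (n + j) n) = 0" if "k < M" for n k
    using AA_rec'[OF that, of n "n + M + 1"] unfolding shift by simp

  have tau_Suc: "Determinant.det (mat M M (\<lambda>(k, j). \<A> (n + (j + 1)) k)) = \<tau> (n + 1)" for n
    by (simp add: \<tau>_eq tau_def)
  have skip: "Determinant.det (mat M M (\<lambda>(k, j). \<A> (n + (if j < s then j else j + 1)) k)) =
      (-1) ^ s * \<Omega> (n + s) n * \<tau> (n + 1)" if "s \<le> M" for n s
    using det_skip_column[of "\<lambda>j. \<Omega> (n + j) n" M "\<lambda>j. \<A> (n + j)" s] diag AA_rec that
    unfolding tau_Suc by simp
  \<comment> \<open>Skipping the last of the columns \<open>n, ..., n + M\<close> leaves exactly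
    those of \<open>\<tau> n\<close>.\<close>
  have tau_rec: "\<tau> n = (-1) ^ M * \<Omega> (n + M) n * \<tau> (n + 1)" for n
  proof -
    have "mat M M (\<lambda>(k, j). \<A> (n + j) k) = mat M M (\<lambda>(k, j). \<A> (n + (if j < M then j else j + 1)) k)"
      by (intro eq_matI) auto
    then show ?thesis
      using skip[of M n] by (simp add: \<tau>_eq tau_def)
  qed

  have "\<tau> 0 \<noteq> 0"
  proof -
    \<comment> \<open>\<open>G\<close> expands monomials in \<open>A\<close>. Column
      \<open>l * p + a\<close> of the monomial matrix at \<open>x k\<close> is
      \<open>x k ^ l\<close> times the unit vector \<open>a\<close>; pairing it with
      \<open>v k\<close> gives the quantities demanded by \<open>tau_0_nonzero\<close>.\<close>
    define G where "G = H \<star> smat_transpose (smat_inv Sb)"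
    have G: "col_finite G"
      unfolding G_def by (intro col_finite_mult gauss_borel_col_finite[OF gb])
    have recover: "vec_index (v k) a * x k ^ l =
        (\<Sum>i\<in>{i. G i (l * p + a) \<noteq> 0}. \<A> i k * G i (l * p + a))" if a: "a < p" and k: "k < M" for a k l
    proof -
      let ?X = "smat_transpose (X_mon p (x k))" and ?K = "{i. G i (l * p + a) \<noteq> 0}"
      have X: "?X c (l * p + a) = (\<Sum>i\<in>?K. A (x k) c i * G i (l * p + a))" for c
      proof -
        have "?X = A (x k) \<star> G"
          unfolding A_eq A_poly_def G_def by (rule gauss_borel_right_recover[OF gb, symmetric])
        then have "?X c (l * p + a) = (A (x k) \<star> G) c (l * p + a)" by simp
        also have "\<dots> = (\<Sum>i\<in>?K. A (x k) c i * G i (l * p + a))"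
          by (rule smat_mult_sum[OF col_finiteD[OF G]]) simp
        finally show ?thesis .
      qed
      have "vec_index (v k) a * x k ^ l = (\<Sum>c\<in>{a}. vec_index (v k) c * ?X c (l * p + a))"
        using a by (simp add: smat_transpose_def X_mon_def)
      also have "\<dots> = (\<Sum>c<p. vec_index (v k) c * ?X c (l * p + a))"
        by (rule sum.mono_neutral_left) (use a in \<open>auto simp: smat_transpose_def X_mon_def\<close>)
      also have "\<dots> = (\<Sum>i\<in>?K. \<A> i k * G i (l * p + a))"
        unfolding X \<A>_eq AA_def sum_distrib_left sum_distrib_right
        by (subst sum.swap) (simp add: mult.assoc)
      finally show ?thesis .
    qed
    have v_nonzero: "\<exists>a<p. vec_index (v k) a \<noteq> 0" if "k < M" for k
    proof (rule ccontr)
      assume "\<not> ?thesis"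
      then have "v k = 0\<^sub>v p"
        using v[OF that] by (intro eq_vecI) auto
      then show False using v[OF that] by simp
    qed
    show ?thesis
      unfolding \<tau>_eq
    proof (rule tau_0_nonzero[of x M \<A> \<Omega> p "\<lambda>k a. vec_index (v k) a"
          G "\<lambda>a l. {i. G i (l * p + a) \<noteq> 0}"])
      show "(\<Sum>j\<le>M. \<A> (n + j) k * \<Omega> (n + j) n) = 0" if "k < M" for n k
        by (rule AA_rec[OF that])
      show "vec_index (v k) a * x k ^ l =
          (\<Sum>i\<in>{i. G i (l * p + a) \<noteq> 0}. \<A> i k * G i (l * p + a))" if "a < p" "k < M" for a l k
        by (rule recover[OF that])
    qed (fact zeros_distinct lead v_nonzero)+
  qed
  then have tau_nonzero: "\<tau> n \<noteq> 0" for n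
  proof (induction n)
    case (Suc n)
    then show ?case using tau_rec[of n] by auto
  qed

  have part1: "\<Omega> (n + M) n = (-1) ^ M * (\<tau> n / \<tau> (n + 1))" for n
    by (rule solve_signed_product[OF tau_rec tau_nonzero])
  have part1_skip: "\<Omega> (n + 1 + i) n = (-1) ^ (i + 1) * (\<tau>s i n / \<tau> (n + 1))" if "i < M" for i n
  proof -
    have "mat M M (\<lambda>(k, j). \<A> (if j \<le> i then n + j else n + j + 1) k) =
        mat M M (\<lambda>(k, j). \<A> (n + (if j < i + 1 then j else j + 1)) k)"
      by (intro eq_matI) auto
    then have "\<tau>s i n = (-1) ^ (i + 1) * \<Omega> (n + (i + 1)) n * \<tau> (n + 1)"
      using skip[of "i + 1" n] that by (simp add: \<tau>s_eq tau_skip_def)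
    from solve_signed_product[OF this tau_nonzero] show ?thesis
      by (simp only: ac_simps)
  qed

  \<comment> \<open>The determinantal formulas for \<open>Bh\<close> and \<open>Ah\<close>\<close>
  have part2: "Bh y (n - 1) b = 1 / \<tau> (n - 1) *
      Determinant.det (mat M M (\<lambda>(i, j). if j = 0 then \<K> n b i y else \<A> (n + (j - 1)) i))"
    if n: "1 \<le> n" for n b y
  proof -
    \<comment> \<open>For \<open>l < n\<close> the sum of \<open>\<A> i k * \<Omega> i l\<close>
      over \<open>i < n + M\<close> vanishes. Weighted with \<open>Bh y l b\<close> and summed over
      \<open>l\<close>, its part \<open>i < n\<close> is the kernel, by
      \<open>B = \<Omega> \<star> Bh\<close>, and the rest has the coefficients
      \<open>g j\<close>.\<close>
    define g where "g j = (\<Sum>l<n. \<Omega> (n + j) l * Bh y l b)" for j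
    have B: "B y i b = (\<Sum>l<n. \<Omega> i l * Bh y l b)" if "i < n" for i
    proof -
      have "B y = \<Omega> \<star> Bh y"
        unfolding B_eq Bh_eq B_poly_def by (rule connection_left[OF conn])
      then have "B y i b = (\<Omega> \<star> Bh y) i b" by simp
      also have "\<dots> = (\<Sum>l<n. \<Omega> i l * Bh y l b)"
        by (rule smat_mult_sum) (use upper that in auto)
      finally show ?thesis .
    qed
    have K: "\<K> n b k y + (\<Sum>j<M. \<A> (n + j) k * g j) = 0" if k: "k < M" for k
    proof -
      have "\<K> n b k y = (\<Sum>i<n. \<A> i k * B y i b)"
        unfolding \<K>_eq KK_def CD_kernel_def \<A>_eq AA_def sum_distrib_left sum_distrib_right
        by (subst sum.swap) (simp add: mult.assoc)
      also have "\<dots> = (\<Sum>l<n. (\<Sum>i<n. \<A> i k * \<Omega> i l) * Bh y l b)"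
        unfolding sum_distrib_right by (subst sum.swap) (simp add: B sum_distrib_left mult.assoc)
      finally have 1: "\<K> n b k y = (\<Sum>l<n. (\<Sum>i<n. \<A> i k * \<Omega> i l) * Bh y l b)" .
      have 2: "(\<Sum>j<M. \<A> (n + j) k * g j) = (\<Sum>l<n. (\<Sum>j<M. \<A> (n + j) k * \<Omega> (n + j) l) * Bh y l b)"
        unfolding g_def sum_distrib_left sum_distrib_right by (subst sum.swap) (simp add: mult.assoc)
      have "\<K> n b k y + (\<Sum>j<M. \<A> (n + j) k * g j) =
          (\<Sum>l<n. (\<Sum>i<n + M. \<A> i k * \<Omega> i l) * Bh y l b)"
        unfolding 1 2 sum_lessThan_add distrib_right sum.distrib ..
      also have "\<dots> = 0"
        using AA_rec'[OF k] by simp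
      finally show ?thesis .
    qed
    \<comment> \<open>Among the columns \<open>l < n\<close>, the band of \<open>\<Omega>\<close>
      leaves only \<open>l = n - 1\<close> in row \<open>n + M - 1\<close>. This isolates the
      desired polynomial.\<close>
    have g_last: "g (M - 1) = \<Omega> (n - 1 + M) (n - 1) * Bh y (n - 1) b"
    proof -
      have "n + (M - 1) = n - 1 + M" using n M_pos by simp
      then have "g (M - 1) = (\<Sum>l<n. \<Omega> (n - 1 + M) l * Bh y l b)"
        by (simp add: g_def)
      also have "\<dots> = (\<Sum>l\<in>{n - 1}. \<Omega> (n - 1 + M) l * Bh y l b)"
        by (rule sum.mono_neutral_right) (use n band in auto)
      finally show ?thesis by simp
    qed
    \<comment> \<open>The kernel becomes column 0 with weight 1. Skipping column \<open>M\<close>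
      gives the determinant of the formula and skipping column 0 gives \<open>\<tau> n\<close>,
      which \<open>tau_rec\<close> converts to \<open>\<tau> (n - 1)\<close>.\<close>
    define c where "c j k = (if j = 0 then \<K> n b k y else \<A> (n + (j - 1)) k)" for j k
    define w where "w j = (if j = 0 then 1 else g (j - 1))" for j
    let ?D = "mat M M (\<lambda>(i, j). if j = 0 then \<K> n b i y else \<A> (n + (j - 1)) i)"
    have rel: "(\<Sum>j\<le>M. c j k * w j) = 0" if "k < M" for k
      using K[OF that] by (simp add: sum.atMost_shift c_def w_def)
    have "?D = mat M M (\<lambda>(k, j). c (if j < M then j else j + 1) k)"
      by (intro eq_matI) (auto simp: c_def)
    then have "Determinant.det ?D = (-1) ^ M * w M * Determinant.det (mat M M (\<lambda>(k, j). c (j + 1) k))"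
      using det_skip_column[of w M c M, OF _ rel] by (simp add: w_def)
    also have "mat M M (\<lambda>(k, j). c (j + 1) k) = mat M M (\<lambda>(k, j). \<A> (n + j) k)"
      by (simp add: c_def)
    also have "Determinant.det \<dots> = \<tau> n"
      by (simp add: \<tau>_eq tau_def)
    also have "w M = \<Omega> (n - 1 + M) (n - 1) * Bh y (n - 1) b"
      using M_pos g_last by (simp add: w_def)
    finally have "Determinant.det ?D =
        ((-1) ^ M * \<Omega> (n - 1 + M) (n - 1) * \<tau> n) * Bh y (n - 1) b"
      by (simp only: ac_simps)
    also have "(-1) ^ M * \<Omega> (n - 1 + M) (n - 1) * \<tau> n = \<tau> (n - 1)"
      using tau_rec[of "n - 1"] n by simp
    finally show ?thesis
      using tau_nonzero[of "n - 1"] by simp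
  qed

  \<comment> \<open>The weights \<open>\<Omega> (n + j) n\<close> annihilate the rows of
    \<open>\<A>\<close>, and on the top row they produce the left-hand side, by
    \<open>A_rec\<close>.\<close>
  have part3: "?RA z a n = 1 / \<tau> (n + 1) * Determinant.det (mat (M + 1) (M + 1)
      (\<lambda>(i, j). if i = 0 then A z a (n + j) else \<A> (n + j) (i - 1)))" if "a < p" for z a n
    using det_bordered[of "\<lambda>j. \<Omega> (n + j) n" M "\<lambda>j. \<A> (n + j)" "\<lambda>j. A z a (n + j)"]
      diag AA_rec A_rec[OF that] tau_nonzero[of "n + 1"]
    unfolding tau_Suc by simp

  show ?thesis
    using tau_nonzero part1 part1_skip part2 part3 by blast
qed

end
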